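(* Let $(\Omega,\Sigma,\mu)$ be a finite (positive) measure space and let $X=L_{1}(\mu,\mathbb{R})$. Then $$wk_{X}(A)=\iota_{1}(A)$$ for each bounded subset $A$ of $X$.
   Context: For a bounded subset $A$ of a Banach space $X$, $wk_X(A)=\sup\{d(x^{**},X): x^{**}\in\overline{A}^{w^{*}}\}$, where $\overline{A}^{w^{*}}$ is the weak$^{*}$ closure of $A$ in $X^{**}$ and $d(x^{**},X)=\inf_{x\in X}\|x^{**}-x\|$. A sequence $(z_n)_n$ in a Banach space $Z$ is weakly $1$-summable if $\sum_n|\langle z^{*},z_n\rangle|<\infty$ for all $z^{*}\in Z^{*}$; then $\|(z_n)_n\|_1^w=\sup\{\sum_n|\langle z^{*},z_n\rangle|: z^{*}\in B_{Z^{*}}\}$, where $B_{Z^*}$ is the closed unit ball of $Z^*$, and $l_1^w(Z)$ denotes the space of such sequences. For a bounded subset $A$ of a Banach space $X$, $$\iota_{1}(A)=\sup\Big\{\limsup_{n}\sup_{x\in A}|\langle x^{*}_{n},x\rangle|: (x^{*}_{n})_{n}\in l^{w}_{1}(X^{*}),\ \|(x^{*}_{n})_{n}\|_{1}^{w}\leq 1\Big\}.$$ *)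

theory Defs
  imports "HOL-Analysis.Analysis"
begin

text \<open>
  The space \<open>L\<^sub>1(\<mu>)\<close> depends on a measure, which is a term, so it cannot be an instance of a
  type class such as \<^class>\<open>banach\<close>. Real normed spaces are therefore given by explicit
  carriers and operations.
\<close>

record 'a nspace =
  vcarrier :: "'a set"
  vadd :: "'a \<Rightarrow> 'a \<Rightarrow> 'a"
  vscale :: "real \<Rightarrow> 'a \<Rightarrow> 'a"
  vnorm :: "'a \<Rightarrow> real"

definition vdiff :: "'a nspace \<Rightarrow> 'a \<Rightarrow> 'a \<Rightarrow> 'a" where
  "vdiff X x y = vadd X x (vscale X (-1) y)"

definition bounded_subset :: "'a nspace \<Rightarrow> 'a set \<Rightarrow> bool" where
  "bounded_subset X A \<longleftrightarrow> A \<subseteq> vcarrier X \<and> (\<exists>C. \<forall>x\<in>A. vnorm X x \<le> C)"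

definition unit_ball :: "'a nspace \<Rightarrow> 'a set" where
  "unit_ball X = {x \<in> vcarrier X. vnorm X x \<le> 1}"

text \<open>
  Functionals are total functions; requiring them to vanish off the carrier makes every
  functional on the carrier have exactly one representative, and this is preserved by the
  pointwise operations.
\<close>

definition bounded_functional :: "'a nspace \<Rightarrow> ('a \<Rightarrow> real) \<Rightarrow> bool" where
  "bounded_functional X \<phi> \<longleftrightarrow>
     (\<forall>x. x \<notin> vcarrier X \<longrightarrow> \<phi> x = 0) \<and>
     (\<forall>x\<in>vcarrier X. \<forall>y\<in>vcarrier X. \<phi> (vadd X x y) = \<phi> x + \<phi> y) \<and>
     (\<forall>c. \<forall>x\<in>vcarrier X. \<phi> (vscale X c x) = c * \<phi> x) \<and>
     (\<exists>C. \<forall>x\<in>vcarrier X. \<bar>\<phi> x\<bar> \<le> C * vnorm X x)"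

definition dual :: "'a nspace \<Rightarrow> ('a \<Rightarrow> real) nspace" where
  "dual X = \<lparr>vcarrier = {\<phi>. bounded_functional X \<phi>},
             vadd = (\<lambda>\<phi> \<psi> x. \<phi> x + \<psi> x),
             vscale = (\<lambda>c \<phi> x. c * \<phi> x),
             vnorm = (\<lambda>\<phi>. SUP x\<in>unit_ball X. \<bar>\<phi> x\<bar>)\<rparr>"

abbreviation bidual :: "'a nspace \<Rightarrow> (('a \<Rightarrow> real) \<Rightarrow> real) nspace" where
  "bidual X \<equiv> dual (dual X)"

definition canonical_embedding :: "'a nspace \<Rightarrow> 'a \<Rightarrow> ('a \<Rightarrow> real) \<Rightarrow> real" where
  "canonical_embedding X x = (\<lambda>\<phi>. if \<phi> \<in> vcarrier (dual X) then \<phi> x else 0)"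

text \<open>
  The weak* topology on the dual of \<open>X\<close>: the initial topology for the evaluations at the
  points of \<open>X\<close>.
\<close>

definition weak_star_topology :: "'a nspace \<Rightarrow> ('a \<Rightarrow> real) topology" where
  "weak_star_topology X =
     pullback_topology (vcarrier (dual X)) (\<lambda>\<phi>. restrict \<phi> (vcarrier X))
       (product_topology (\<lambda>_. euclideanreal) (vcarrier X))"

text \<open>
  The suprema below are taken in \<^typ>\<open>ennreal\<close>, where every supremum of nonnegative
  quantities exists and the supremum of the empty set is \<open>0\<close>.
\<close>

definition dist_to_space :: "'a nspace \<Rightarrow> (('a \<Rightarrow> real) \<Rightarrow> real) \<Rightarrow> ennreal" where
  "dist_to_space X F =
     (INF x\<in>vcarrier X. ennreal (vnorm (bidual X) (vdiff (bidual X) F (canonical_embedding X x))))"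

definition wk :: "'a nspace \<Rightarrow> 'a set \<Rightarrow> ennreal" where
  "wk X A =
     (SUP F \<in> (weak_star_topology (dual X)) closure_of (canonical_embedding X ` A).
        dist_to_space X F)"

definition weakly_1_summable :: "'a nspace \<Rightarrow> (nat \<Rightarrow> 'a) \<Rightarrow> bool" where
  "weakly_1_summable Z z \<longleftrightarrow>
     (\<forall>n. z n \<in> vcarrier Z) \<and> (\<forall>\<phi>\<in>vcarrier (dual Z). summable (\<lambda>n. \<bar>\<phi> (z n)\<bar>))"

definition weak_1_norm :: "'a nspace \<Rightarrow> (nat \<Rightarrow> 'a) \<Rightarrow> ennreal" where
  "weak_1_norm Z z = (SUP \<phi>\<in>unit_ball (dual Z). \<Sum>n. ennreal \<bar>\<phi> (z n)\<bar>)"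

definition iota1 :: "'a nspace \<Rightarrow> 'a set \<Rightarrow> ennreal" where
  "iota1 X A =
     (SUP f \<in> {f. weakly_1_summable (dual X) f \<and> weak_1_norm (dual X) f \<le> 1}.
        limsup (\<lambda>n. SUP x\<in>A. ennreal \<bar>f n x\<bar>))"

text \<open>Elements of \<open>L\<^sub>1(\<mu>, \<real>)\<close> are classes of integrable functions modulo equality a.e.\<close>

definition ae_eq_rel :: "'b measure \<Rightarrow> (('b \<Rightarrow> real) \<times> ('b \<Rightarrow> real)) set" where
  "ae_eq_rel M = {(f, g). integrable M f \<and> integrable M g \<and> (AE x in M. f x = g x)}"

definition l1_class :: "'b measure \<Rightarrow> ('b \<Rightarrow> real) \<Rightarrow> ('b \<Rightarrow> real) set" where
  "l1_class M f = ae_eq_rel M `` {f}"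

definition l1_rep :: "('b \<Rightarrow> real) set \<Rightarrow> 'b \<Rightarrow> real" where
  "l1_rep F = (SOME f. f \<in> F)"

definition L1 :: "'b measure \<Rightarrow> ('b \<Rightarrow> real) set nspace" where
  "L1 M = \<lparr>vcarrier = {f. integrable M f} // ae_eq_rel M,
           vadd = (\<lambda>F G. l1_class M (\<lambda>x. l1_rep F x + l1_rep G x)),
           vscale = (\<lambda>c F. l1_class M (\<lambda>x. c * l1_rep F x)),
           vnorm = (\<lambda>F. \<integral>x. \<bar>l1_rep F x\<bar> \<partial>M)\<rparr>"

text \<open>The operations of \<open>L1 M\<close> do not depend on the chosen representatives.\<close>

lemma equiv_ae_eq_rel: "equiv {f. integrable M f} (ae_eq_rel M)"
proof (rule equivI)
  show "ae_eq_rel M \<subseteq> {f. integrable M f} \<times> {f. integrable M f}"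
    by (auto simp: ae_eq_rel_def)
  show "refl_on {f. integrable M f} (ae_eq_rel M)"
    by (auto simp: refl_on_def ae_eq_rel_def)
  show "sym (ae_eq_rel M)"
    by (auto simp: sym_def ae_eq_rel_def elim: AE_mp)
  show "trans (ae_eq_rel M)"
    by (auto simp: trans_def ae_eq_rel_def elim!: AE_mp)
qed

lemma l1_class_eq_iff:
  assumes "integrable M f" "integrable M g"
  shows "l1_class M f = l1_class M g \<longleftrightarrow> (AE x in M. f x = g x)"
  using eq_equiv_class_iff[OF equiv_ae_eq_rel, of f M g] assms
  by (auto simp: l1_class_def ae_eq_rel_def)

lemma l1_class_in_L1: "integrable M f \<Longrightarrow> l1_class M f \<in> vcarrier (L1 M)"
  by (auto simp: L1_def l1_class_def quotient_def)

lemma l1_rep_class: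
  assumes "integrable M f"
  shows "integrable M (l1_rep (l1_class M f))" "AE x in M. l1_rep (l1_class M f) x = f x"
proof -
  have "f \<in> l1_class M f"
    using assms by (auto simp: l1_class_def ae_eq_rel_def)
  then have "l1_rep (l1_class M f) \<in> l1_class M f"
    unfolding l1_rep_def by (rule someI[where P = "\<lambda>h. h \<in> l1_class M f"])
  then have *: "integrable M (l1_rep (l1_class M f))" "AE x in M. f x = l1_rep (l1_class M f) x"
    by (auto simp: l1_class_def ae_eq_rel_def)
  show "integrable M (l1_rep (l1_class M f))"
    by (rule *(1))
  show "AE x in M. l1_rep (l1_class M f) x = f x"
    using *(2) by (rule AE_mp) auto
qed

lemma L1_add_class:
  assumes "integrable M f" "integrable M g"
  shows "vadd (L1 M) (l1_class M f) (l1_class M g) = l1_class M (\<lambda>x. f x + g x)"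
proof -
  have "AE x in M. l1_rep (l1_class M f) x + l1_rep (l1_class M g) x = f x + g x"
    using l1_rep_class(2)[OF assms(1)] l1_rep_class(2)[OF assms(2)] by eventually_elim simp
  then show ?thesis
    by (simp add: L1_def l1_class_eq_iff l1_rep_class(1) assms)
qed

lemma L1_scale_class:
  assumes "integrable M f"
  shows "vscale (L1 M) c (l1_class M f) = l1_class M (\<lambda>x. c * f x)"
proof -
  have "AE x in M. c * l1_rep (l1_class M f) x = c * f x"
    using l1_rep_class(2)[OF assms] by eventually_elim simp
  then show ?thesis
    by (simp add: L1_def l1_class_eq_iff l1_rep_class(1) assms)
qed

lemma L1_norm_class:
  assumes "integrable M f"
  shows "vnorm (L1 M) (l1_class M f) = (\<integral>x. \<bar>f x\<bar> \<partial>M)"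
proof -
  have "AE x in M. \<bar>l1_rep (l1_class M f) x\<bar> = \<bar>f x\<bar>"
    using l1_rep_class(2)[OF assms] by eventually_elim simp
  then show ?thesis
    using l1_rep_class(1)[OF assms] assms by (auto simp: L1_def intro!: integral_cong_AE)
qed

end

theory Submission
  imports Defs
begin

text \<open>
Let \<open>A\<close> be a bounded set of integrable functions. Both sides measure how far \<open>A\<close> is from being
uniformly integrable, and the two inequalities are proved by different means.

The inequality \<open>iota1 X A \<le> wk X A\<close> holds in every space \<open>X\<close> (\<open>iota1_le_wk\<close>). A sequence of functionals
\<open>f n\<close> has weak norm at most 1 exactly when the sum of the \<open>\<bar>f n x\<bar>\<close> is at most the norm of \<open>x\<close>, for every
\<open>x\<close>. If \<open>\<bar>f n (u n)\<bar> > c\<close> for points \<open>u n\<close> of \<open>A\<close> and infinitely many \<open>n\<close>, then Rosenthal's lemma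
(\<open>rosenthal\<close>) gives an infinite set of indices along which the off-diagonal values \<open>f j (u k)\<close> are
negligible. Choosing signs that make the diagonal values positive, the tails \<open>g m\<close> of the signed series of
the \<open>f n\<close> lie in the dual unit ball, are almost \<open>c\<close> at all later \<open>u k\<close>, hence also at a weak* cluster
point \<open>F\<close> of the \<open>u k\<close>, and yet tend to 0 at every single point of \<open>X\<close>. So \<open>F\<close> has distance at least
almost \<open>c\<close> from \<open>X\<close> (\<open>far_cluster_point\<close>).

For the converse let \<open>X\<close> be the space of integrable functions and look at the tails, the integrals of
\<open>\<bar>f\<bar>\<close> over \<open>{\<bar>f\<bar> > K}\<close> for \<open>f\<close> in \<open>A\<close>.
If some \<open>K\<close> makes all of them at most \<open>c\<close>, then truncation at \<open>K\<close> moves the points of \<open>A\<close> by at most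
\<open>c\<close> into an order interval, which is weakly compact: a weak* limit of truncated functions, as a functional
of bounded functions \<open>g\<close>, is bounded by \<open>K\<close> times the integral of \<open>\<bar>g\<bar>\<close> and therefore has a density, by
the Radon-Nikodym theorem. Hence \<open>wk X A \<le> c\<close> (\<open>wk_L1_le_if_tails_le\<close>).
If for every \<open>K\<close> some tail exceeds \<open>c\<close>, then these tails live on sets whose measures can be taken
summable. Passing to a subsequence the sets can be made disjoint at arbitrarily small cost, and the sign
functions of the tails on the disjoint sets form a sequence of functionals of weak norm at most 1
that witnesses \<open>iota1 X A \<ge> c\<close> up to that cost (\<open>iota1_L1_ge_if_tails_large\<close>).
\<close>

section \<open>Real series and filters\<close>

lemma partial_sums_bounded_imp_suminf_le:
  fixes f :: "nat \<Rightarrow> real"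
  assumes "\<And>n. 0 \<le> f n" "\<And>n. (\<Sum>k<n. f k) \<le> C"
  shows "summable f" "(\<Sum>n. f n) \<le> C"
proof -
  show "summable f"
    using assms by (intro summableI_nonneg_bounded)
  then show "(\<Sum>n. f n) \<le> C"
    using assms(2) by (intro suminf_le_const)
qed

lemma suminf_tail_tendsto_0:
  fixes t :: "nat \<Rightarrow> real"
  assumes "summable t"
  shows "(\<lambda>m. \<Sum>n. t (n + m)) \<longlonglongrightarrow> 0"
proof -
  have "(\<lambda>m. (\<Sum>n. t n) - (\<Sum>i<m. t i)) \<longlonglongrightarrow> (\<Sum>n. t n) - (\<Sum>n. t n)"
    by (intro tendsto_diff tendsto_const summable_LIMSEQ assms)
  then show ?thesis using suminf_minus_initial_segment[OF assms] by simp
qed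

text \<open>
Tychonoff's theorem in the form in which it replaces the passage to a convergent subnet: the refined filter
\<open>G\<close> plays the role of the subnet.
\<close>

lemma tychonoff_filter:
  fixes h :: "'x \<Rightarrow> 'i \<Rightarrow> real"
  assumes F: "F \<noteq> bot" and bound: "\<And>i. eventually (\<lambda>x. \<bar>h x i\<bar> \<le> B i) F"
  obtains G L where "G \<le> F" "G \<noteq> bot" "\<And>i. ((\<lambda>x. h x i) \<longlongrightarrow> L i) G"
proof -
  define K where "K = (PiE UNIV (\<lambda>i. {- B i..B i}))"
  have "compactin (product_topology (\<lambda>i::'i. euclidean) UNIV) K"
    unfolding K_def by (subst compactin_PiE) auto
  then have K: "compact K"
    by (simp add: euclidean_product_topology)
  \<comment> \<open>Clipping puts all values of \<open>h\<close> into the compact box and changes each coordinate only off a set in \<open>F\<close>.\<close>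
  define c where "c x i = max (- B i) (min (B i) (h x i))" for x i
  have B: "B i \<ge> 0" for i
    using eventually_happens'[OF F bound[of i]] by auto
  have cK: "c x \<in> K" for x
    using B by (auto simp: K_def c_def min_def max_def minus_le_iff)
  have "filtermap c F \<noteq> bot" "filtermap c F \<le> principal K"
    using F cK by (auto simp: filtermap_bot_iff le_principal eventually_filtermap)
  then obtain L where L: "inf (nhds L) (filtermap c F) \<noteq> bot"
    using K unfolding compact_filter by (metis eventually_principal le_principal)
  define G where "G = inf F (filtercomap c (nhds L))"
  have "G \<noteq> bot"
  proof
    assume "G = bot"
    then obtain P Q where P: "eventually P F" and Q: "eventually Q (nhds L)"
      and PQ: "\<And>x. P x \<Longrightarrow> Q (c x) \<Longrightarrow> False"
      unfolding G_def trivial_limit_def eventually_inf eventually_filtercomap by blast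
    have "eventually (\<lambda>y. \<not> Q y) (filtermap c F)"
      using P PQ unfolding eventually_filtermap by (auto elim!: eventually_mono)
    then have "eventually (\<lambda>_. False) (inf (nhds L) (filtermap c F))"
      using Q by (auto simp: eventually_inf)
    then show False using L by (simp add: trivial_limit_def)
  qed
  moreover have "G \<le> F" by (simp add: G_def)
  moreover have "((\<lambda>x. h x i) \<longlongrightarrow> L i) G" for i
  proof -
    have "(c \<longlongrightarrow> L) G"
      unfolding G_def filterlim_iff_le_filtercomap by simp
    then have "((\<lambda>x. c x i) \<longlongrightarrow> L i) G"
      using continuous_on_tendsto_compose[OF continuous_on_product_coordinates[of i]] by simp
    moreover have "eventually (\<lambda>x. c x i = h x i) G"
      using filter_leD[OF \<open>G \<le> F\<close> bound[of i]] by eventually_elim (auto simp: c_def)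
    ultimately show ?thesis by (rule Lim_transform_eventually)
  qed
  ultimately show thesis by (intro that)
qed

section \<open>Functionals on spaces with a homogeneous norm\<close>

lemma functional_boundE:
  assumes "\<phi> \<in> vcarrier (dual X)"
  obtains C where "\<And>x. x \<in> vcarrier X \<Longrightarrow> \<bar>\<phi> x\<bar> \<le> C * vnorm X x"
  using assms unfolding dual_def bounded_functional_def mem_Collect_eq nspace.simps by blast

lemma functionalI:
  assumes "\<And>x. x \<notin> vcarrier X \<Longrightarrow> \<phi> x = 0"
    and "\<And>x y. x \<in> vcarrier X \<Longrightarrow> y \<in> vcarrier X \<Longrightarrow> \<phi> (vadd X x y) = \<phi> x + \<phi> y"
    and "\<And>c x. x \<in> vcarrier X \<Longrightarrow> \<phi> (vscale X c x) = c * \<phi> x"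
    and "\<And>x. x \<in> vcarrier X \<Longrightarrow> \<bar>\<phi> x\<bar> \<le> C * vnorm X x"
  shows "\<phi> \<in> vcarrier (dual X)"
  using assms unfolding dual_def bounded_functional_def mem_Collect_eq nspace.simps by blast

lemma functional_off_carrier:
  "\<phi> \<in> vcarrier (dual X) \<Longrightarrow> x \<notin> vcarrier X \<Longrightarrow> \<phi> x = 0"
  by (simp add: dual_def bounded_functional_def)

lemma functional_add:
  "\<phi> \<in> vcarrier (dual X) \<Longrightarrow> x \<in> vcarrier X \<Longrightarrow> y \<in> vcarrier X \<Longrightarrow> \<phi> (vadd X x y) = \<phi> x + \<phi> y"
  by (simp add: dual_def bounded_functional_def)

lemma functional_scale:
  "\<phi> \<in> vcarrier (dual X) \<Longrightarrow> x \<in> vcarrier X \<Longrightarrow> \<phi> (vscale X c x) = c * \<phi> x"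
  by (simp add: dual_def bounded_functional_def)

lemma dual_add [simp]: "vadd (dual X) \<phi> \<psi> = (\<lambda>x. \<phi> x + \<psi> x)"
  and dual_scale [simp]: "vscale (dual X) c \<phi> = (\<lambda>x. c * \<phi> x)"
  by (simp_all add: dual_def)

text \<open>
The properties by which a point is rescaled into the unit ball and a bounded functional is estimated by its
norm. They pass from a space to its dual (\<open>homogeneous_norm_dual\<close>), so every result about the dual also
applies to the bidual.
\<close>

locale homogeneous_norm =
  fixes X :: "'a nspace"
  assumes carrier_nonempty: "vcarrier X \<noteq> {}"
    and scale_closed: "x \<in> vcarrier X \<Longrightarrow> vscale X c x \<in> vcarrier X"
    and norm_nonneg: "x \<in> vcarrier X \<Longrightarrow> 0 \<le> vnorm X x"
    and norm_scale: "x \<in> vcarrier X \<Longrightarrow> vnorm X (vscale X c x) = \<bar>c\<bar> * vnorm X x"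
begin

lemma unit_ball_nonempty: "unit_ball X \<noteq> {}"
proof -
  obtain x where "x \<in> vcarrier X" using carrier_nonempty by auto
  then have "vscale X 0 x \<in> unit_ball X"
    by (simp add: unit_ball_def scale_closed norm_scale)
  then show ?thesis by auto
qed

lemma bdd_above_functional:
  assumes "\<And>x. x \<in> vcarrier X \<Longrightarrow> \<bar>\<phi> x\<bar> \<le> C * vnorm X x"
  shows "bdd_above ((\<lambda>x. \<bar>\<phi> x\<bar>) ` unit_ball X)"
proof (rule bdd_aboveI2)
  fix x assume x: "x \<in> unit_ball X"
  then have "\<bar>\<phi> x\<bar> \<le> C * vnorm X x" using assms by (auto simp: unit_ball_def)
  also have "\<dots> \<le> \<bar>C\<bar> * 1"
    using x norm_nonneg[of x] by (intro mult_mono) (auto simp: unit_ball_def)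
  finally show "\<bar>\<phi> x\<bar> \<le> \<bar>C\<bar>" by simp
qed

lemma dual_norm_nonneg:
  assumes "\<And>x. x \<in> vcarrier X \<Longrightarrow> \<bar>\<phi> x\<bar> \<le> C * vnorm X x"
  shows "0 \<le> vnorm (dual X) \<phi>"
proof -
  obtain x where "x \<in> unit_ball X" using unit_ball_nonempty by auto
  then have "\<bar>\<phi> x\<bar> \<le> vnorm (dual X) \<phi>"
    using cSUP_upper[OF _ bdd_above_functional[OF assms]] by (simp add: dual_def)
  then show ?thesis by linarith
qed

lemma functional_le:
  assumes \<phi>: "\<phi> \<in> vcarrier (dual X)" and x: "x \<in> vcarrier X"
  shows "\<bar>\<phi> x\<bar> \<le> vnorm (dual X) \<phi> * vnorm X x"
proof -
  obtain C where C: "\<And>x. x \<in> vcarrier X \<Longrightarrow> \<bar>\<phi> x\<bar> \<le> C * vnorm X x"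
    using \<phi> functional_boundE by blast
  note hom = functional_scale[OF \<phi> x]
  show ?thesis
  proof (cases "vnorm X x = 0")
    case True
    then show ?thesis using C[OF x] by simp
  next
    case False
    then have pos: "vnorm X x > 0" using norm_nonneg[OF x] by simp
    let ?y = "vscale X (1 / vnorm X x) x"
    have "?y \<in> unit_ball X"
      using x pos by (simp add: unit_ball_def scale_closed norm_scale)
    then have "\<bar>\<phi> ?y\<bar> \<le> vnorm (dual X) \<phi>"
      using cSUP_upper[OF _ bdd_above_functional[OF C]] by (simp add: dual_def)
    then show ?thesis
      using pos by (simp add: hom abs_mult field_simps)
  qed
qed

lemma functional_le_on_unit_ball:
  assumes "\<phi> \<in> vcarrier (dual X)" "x \<in> unit_ball X"
  shows "\<bar>\<phi> x\<bar> \<le> vnorm (dual X) \<phi>"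
proof -
  obtain C where C: "\<And>x. x \<in> vcarrier X \<Longrightarrow> \<bar>\<phi> x\<bar> \<le> C * vnorm X x"
    using assms functional_boundE by blast
  show ?thesis
    using cSUP_upper[OF assms(2) bdd_above_functional[OF C]] by (simp add: dual_def)
qed

lemma dual_norm_le:
  assumes "\<And>x. x \<in> unit_ball X \<Longrightarrow> \<bar>\<phi> x\<bar> \<le> B"
  shows "vnorm (dual X) \<phi> \<le> B"
  using assms unit_ball_nonempty by (auto simp: dual_def intro: cSUP_least)

lemma dual_add_closed:
  assumes "\<phi> \<in> vcarrier (dual X)" "\<psi> \<in> vcarrier (dual X)"
  shows "(\<lambda>x. \<phi> x + \<psi> x) \<in> vcarrier (dual X)"
proof -
  obtain C where C: "\<And>x. x \<in> vcarrier X \<Longrightarrow> \<bar>\<phi> x\<bar> \<le> C * vnorm X x"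
    using assms functional_boundE by blast
  obtain D where D: "\<And>x. x \<in> vcarrier X \<Longrightarrow> \<bar>\<psi> x\<bar> \<le> D * vnorm X x"
    using assms functional_boundE by blast
  have "\<bar>\<phi> x + \<psi> x\<bar> \<le> (C + D) * vnorm X x" if "x \<in> vcarrier X" for x
    using C[OF that] D[OF that] by (simp add: distrib_right)
  then show ?thesis
    using assms
    by (intro functionalI[where C = "C + D"])
      (auto simp: functional_off_carrier functional_add functional_scale algebra_simps)
qed

lemma dual_scale_closed:
  assumes "\<phi> \<in> vcarrier (dual X)"
  shows "(\<lambda>x. c * \<phi> x) \<in> vcarrier (dual X)"
proof -
  obtain C where C: "\<And>x. x \<in> vcarrier X \<Longrightarrow> \<bar>\<phi> x\<bar> \<le> C * vnorm X x"
    using assms functional_boundE by blast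
  have "\<bar>c * \<phi> x\<bar> \<le> (\<bar>c\<bar> * C) * vnorm X x" if "x \<in> vcarrier X" for x
    using mult_left_mono[OF C[OF that], of "\<bar>c\<bar>"] by (simp add: abs_mult mult.assoc)
  then show ?thesis
    using assms
    by (intro functionalI[where C = "\<bar>c\<bar> * C"])
      (auto simp: functional_off_carrier functional_add functional_scale algebra_simps)
qed

lemma homogeneous_norm_dual: "homogeneous_norm (dual X)"
proof
  have "(\<lambda>_. 0) \<in> vcarrier (dual X)"
    by (auto simp: dual_def bounded_functional_def intro: exI[of _ 0])
  then show "vcarrier (dual X) \<noteq> {}" by auto
next
  fix \<phi> c assume \<phi>: "\<phi> \<in> vcarrier (dual X)"
  then show "vscale (dual X) c \<phi> \<in> vcarrier (dual X)"
    using dual_scale_closed[OF \<phi>, of c] by (simp add: dual_def)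
  show "0 \<le> vnorm (dual X) \<phi>"
    using \<phi> dual_norm_nonneg functional_boundE by blast
  have le: "vnorm (dual X) (\<lambda>x. c * \<psi> x) \<le> \<bar>c\<bar> * vnorm (dual X) \<psi>"
    if "\<psi> \<in> vcarrier (dual X)" for c \<psi>
    using functional_le_on_unit_ball[OF that]
    by (intro dual_norm_le) (auto simp: abs_mult intro: mult_left_mono)
  have "vnorm (dual X) (\<lambda>x. c * \<phi> x) = \<bar>c\<bar> * vnorm (dual X) \<phi>"
  proof (cases "c = 0")
    case True
    then show ?thesis using unit_ball_nonempty by (simp add: dual_def)
  next
    case False
    have "vnorm (dual X) \<phi> \<le> \<bar>1 / c\<bar> * vnorm (dual X) (\<lambda>x. c * \<phi> x)"
      using le[OF dual_scale_closed[OF \<phi>, of c], of "1 / c"] False by simp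
    then show ?thesis using le[OF \<phi>, of c] False by (simp add: field_simps)
  qed
  then show "vnorm (dual X) (vscale (dual X) c \<phi>) = \<bar>c\<bar> * vnorm (dual X) \<phi>"
    by (simp add: dual_def)
qed

lemma functional_le_of_norm_le:
  assumes \<phi>: "\<phi> \<in> vcarrier (dual X)" and x: "x \<in> vcarrier X" "vnorm X x \<le> C"
  shows "\<bar>\<phi> x\<bar> \<le> C * vnorm (dual X) \<phi>"
proof -
  interpret D: homogeneous_norm "dual X" by (rule homogeneous_norm_dual)
  have "\<bar>\<phi> x\<bar> \<le> vnorm (dual X) \<phi> * vnorm X x" by (rule functional_le[OF \<phi> x(1)])
  also have "\<dots> \<le> vnorm (dual X) \<phi> * C"
    using x(2) D.norm_nonneg[OF \<phi>] by (intro mult_left_mono)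
  finally show ?thesis by (simp add: mult.commute)
qed

lemma canonical_embedding_in_bidual:
  assumes "x \<in> vcarrier X"
  shows "canonical_embedding X x \<in> vcarrier (bidual X)"
proof -
  have "\<bar>\<phi> x\<bar> \<le> vnorm X x * vnorm (dual X) \<phi>" if "\<phi> \<in> vcarrier (dual X)" for \<phi>
    using functional_le[OF that assms] by (simp add: mult.commute)
  then show ?thesis
    using dual_add_closed dual_scale_closed
    by (intro functionalI) (auto simp: canonical_embedding_def)
qed

lemma canonical_embedding_in_unit_ball:
  assumes "x \<in> unit_ball X"
  shows "canonical_embedding X x \<in> unit_ball (bidual X)"
proof -
  interpret D: homogeneous_norm "dual X" by (rule homogeneous_norm_dual)
  have "\<bar>canonical_embedding X x \<phi>\<bar> \<le> 1" if \<phi>: "\<phi> \<in> unit_ball (dual X)" for \<phi>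
  proof -
    have "\<bar>\<phi> x\<bar> \<le> vnorm (dual X) \<phi>"
      using functional_le_on_unit_ball assms \<phi> by (auto simp: unit_ball_def)
    then show ?thesis using \<phi> by (auto simp: canonical_embedding_def unit_ball_def)
  qed
  then have "vnorm (bidual X) (canonical_embedding X x) \<le> 1" by (rule D.dual_norm_le)
  then show ?thesis
    using assms canonical_embedding_in_bidual by (auto simp: unit_ball_def)
qed

section \<open>Weakly 1-summable sequences of functionals\<close>

lemma signed_sum_in_dual:
  fixes n :: nat
  assumes "\<And>k. f k \<in> vcarrier (dual X)"
  shows "(\<lambda>x. \<Sum>k<n. s k * f k x) \<in> vcarrier (dual X)"
proof (induction n)
  case 0
  then show ?case by (auto intro: functionalI[where C = 0])
next
  case (Suc n)
  then show ?case
    using dual_add_closed[OF Suc dual_scale_closed[OF assms]] by simp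
qed

lemma functional_signed_sum:
  fixes n :: nat
  assumes "\<Phi> \<in> vcarrier (bidual X)" "\<And>k. f k \<in> vcarrier (dual X)"
  shows "\<Phi> (\<lambda>x. \<Sum>k<n. s k * f k x) = (\<Sum>k<n. s k * \<Phi> (f k))"
proof (induction n)
  case 0
  have "(\<lambda>x. 0 * f 0 x) = (\<lambda>x. 0)" by auto
  then show ?case using functional_scale[OF assms(1) assms(2), of 0 0] by simp
next
  case (Suc n)
  have sum: "(\<lambda>x. \<Sum>k<n. s k * f k x) \<in> vcarrier (dual X)"
    by (rule signed_sum_in_dual[OF assms(2)])
  have last: "(\<lambda>x. s n * f n x) \<in> vcarrier (dual X)"
    by (rule dual_scale_closed[OF assms(2)])
  from Suc show ?case
    using functional_add[OF assms(1) sum last] functional_scale[OF assms(1) assms(2)] by simp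
qed

text \<open>
The value of an element \<open>\<Phi>\<close> of the bidual at \<open>\<Sum>k<n. \<plusminus> f k\<close>, with the signs of the \<open>\<Phi> (f k)\<close>, is
\<open>\<Sum>k<n. \<bar>\<Phi> (f k)\<bar>\<close>, and the hypothesis puts this signed sum into the dual unit ball. Thus it suffices to
control the sequence at the points of \<open>X\<close>.
\<close>

lemma weak_1_norm_le_1I:
  assumes f: "\<And>k. f k \<in> vcarrier (dual X)"
    and le: "\<And>(n :: nat) x. x \<in> vcarrier X \<Longrightarrow> (\<Sum>k<n. \<bar>f k x\<bar>) \<le> vnorm X x"
  shows "weakly_1_summable (dual X) f" "weak_1_norm (dual X) f \<le> 1"
proof -
  interpret D: homogeneous_norm "dual X" by (rule homogeneous_norm_dual)
  have sum_le: "(\<Sum>k<n. \<bar>\<Phi> (f k)\<bar>) \<le> vnorm (bidual X) \<Phi>"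
    if \<Phi>: "\<Phi> \<in> vcarrier (bidual X)" for \<Phi> and n :: nat
  proof -
    let ?g = "\<lambda>x. \<Sum>k<n. sgn (\<Phi> (f k)) * f k x"
    have "\<bar>?g x\<bar> \<le> 1" if "x \<in> unit_ball X" for x
    proof -
      have "\<bar>?g x\<bar> \<le> (\<Sum>k<n. \<bar>sgn (\<Phi> (f k)) * f k x\<bar>)" by (rule sum_abs)
      also have "\<dots> \<le> (\<Sum>k<n. \<bar>f k x\<bar>)"
        by (intro sum_mono) (auto simp: abs_mult sgn_if)
      also have "\<dots> \<le> 1" using le[of x n] that by (auto simp: unit_ball_def)
      finally show ?thesis .
    qed
    then have "?g \<in> unit_ball (dual X)"
      using dual_norm_le signed_sum_in_dual[OF f] by (auto simp: unit_ball_def)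
    then have "\<bar>\<Phi> ?g\<bar> \<le> vnorm (bidual X) \<Phi>"
      by (rule D.functional_le_on_unit_ball[OF \<Phi>])
    moreover have "\<Phi> ?g = (\<Sum>k<n. \<bar>\<Phi> (f k)\<bar>)"
      using functional_signed_sum[OF \<Phi>, where f = f and s = "\<lambda>k. sgn (\<Phi> (f k))" and n = n] f
      by (simp add: abs_sgn mult.commute)
    ultimately show ?thesis by linarith
  qed
  show "weakly_1_summable (dual X) f"
    unfolding weakly_1_summable_def
    using f partial_sums_bounded_imp_suminf_le(1)[OF _ sum_le] by auto
  show "weak_1_norm (dual X) f \<le> 1"
    unfolding weak_1_norm_def
  proof (rule SUP_least)
    fix \<Phi> assume "\<Phi> \<in> unit_ball (bidual X)"
    then have \<Phi>: "\<Phi> \<in> vcarrier (bidual X)" "vnorm (bidual X) \<Phi> \<le> 1"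
      by (auto simp: unit_ball_def)
    have *: "(\<Sum>n. \<bar>\<Phi> (f n)\<bar>) \<le> 1" "summable (\<lambda>n. \<bar>\<Phi> (f n)\<bar>)"
      using sum_le[OF \<Phi>(1)] \<Phi>(2)
      by (intro partial_sums_bounded_imp_suminf_le[where C = 1]; force intro: order_trans)+
    then show "(\<Sum>n. ennreal \<bar>\<Phi> (f n)\<bar>) \<le> 1"
      by (simp add: suminf_ennreal2)
  qed
qed

text \<open>
Conversely, the points of the unit ball of \<open>X\<close> are elements of the unit ball of the bidual. Finite sums
over arbitrary index sets are the form that Rosenthal's lemma and the tails of series ask for.
\<close>

lemma sum_le_if_weak_1_norm_le_1:
  assumes f: "weakly_1_summable (dual X) f" "weak_1_norm (dual X) f \<le> 1"
    and x: "x \<in> vcarrier X" and "finite S"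
  shows "(\<Sum>k\<in>S. \<bar>f k x\<bar>) \<le> vnorm X x"
proof -
  have fd: "f k \<in> vcarrier (dual X)" for k
    using f by (auto simp: weakly_1_summable_def)
  have ball: "(\<Sum>k\<in>S. \<bar>f k y\<bar>) \<le> 1" if y: "y \<in> unit_ball X" for y
  proof -
    have "ennreal (\<Sum>k\<in>S. \<bar>f k y\<bar>) = (\<Sum>k\<in>S. ennreal \<bar>f k y\<bar>)"
      by simp
    also have "\<dots> \<le> (\<Sum>k. ennreal \<bar>f k y\<bar>)"
      by (rule sum_le_suminf[OF _ \<open>finite S\<close>]) auto
    also have "\<dots> = (\<Sum>k. ennreal \<bar>canonical_embedding X y (f k)\<bar>)"
      using fd by (simp add: canonical_embedding_def)
    also have "\<dots> \<le> weak_1_norm (dual X) f"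
      unfolding weak_1_norm_def by (rule SUP_upper[OF canonical_embedding_in_unit_ball[OF y]])
    also have "\<dots> \<le> 1" by fact
    finally show ?thesis by (simp add: sum_nonneg)
  qed
  show ?thesis
  proof (cases "vnorm X x = 0")
    case True
    then have "f k x = 0" for k using functional_le[OF fd x, of k] by simp
    then show ?thesis using norm_nonneg[OF x] by simp
  next
    case False
    then have pos: "vnorm X x > 0" using norm_nonneg[OF x] by simp
    let ?y = "vscale X (1 / vnorm X x) x"
    have "?y \<in> unit_ball X"
      using x pos by (simp add: unit_ball_def scale_closed norm_scale)
    from ball[OF this] have "(\<Sum>k\<in>S. \<bar>f k x\<bar>) / vnorm X x \<le> 1"
      using pos by (simp add: functional_scale[OF fd x] abs_mult sum_divide_distrib)
    then show ?thesis using pos by (simp add: field_simps)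
  qed
qed

section \<open>Weak* closure and weak* compactness through filters\<close>

text \<open>
The traces on \<open>A\<close> of the weak* neighbourhoods of \<open>F\<close> generate the filter.
\<close>

lemma weak_star_closure_imp_filter:
  assumes "F \<in> weak_star_topology (dual X) closure_of (canonical_embedding X ` A)"
  obtains \<F> where "\<F> \<noteq> bot" "\<F> \<le> principal A"
    "\<And>\<phi>. \<phi> \<in> vcarrier (dual X) \<Longrightarrow> ((\<lambda>x. \<phi> x) \<longlongrightarrow> F \<phi>) \<F>"
proof -
  let ?W = "weak_star_topology (dual X)"
  let ?P = "product_topology (\<lambda>_. euclideanreal) (vcarrier (dual X))"
  have FW: "F \<in> topspace ?W"
    and cl: "\<And>U. openin ?W U \<Longrightarrow> F \<in> U \<Longrightarrow> \<exists>x\<in>A. canonical_embedding X x \<in> U"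
    using assms by (auto simp: in_closure_of)
  have F: "F \<in> vcarrier (bidual X)"
    using FW by (auto simp: weak_star_topology_def topspace_pullback_topology)
  define N where "N = {U. openin ?W U \<and> F \<in> U}"
  define \<F> where "\<F> = (INF U\<in>N. principal {x\<in>A. canonical_embedding X x \<in> U})"
  have "topspace ?W \<in> N" using FW by (auto simp: N_def)
  then have ev: "eventually P \<F> \<longleftrightarrow> (\<exists>U\<in>N. \<forall>x\<in>A. canonical_embedding X x \<in> U \<longrightarrow> P x)" for P
    unfolding \<F>_def
  proof (subst eventually_INF_base)
    fix U V assume "U \<in> N" "V \<in> N"
    then have "U \<inter> V \<in> N" by (auto simp: N_def)
    then show "\<exists>Y\<in>N. principal {x\<in>A. canonical_embedding X x \<in> Y}
        \<le> inf (principal {x\<in>A. canonical_embedding X x \<in> U}) (principal {x\<in>A. canonical_embedding X x \<in> V})"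
      by (intro bexI[of _ "U \<inter> V"]) auto
  qed (auto simp: eventually_principal)
  show thesis
  proof
    show "\<F> \<noteq> bot"
      using cl by (auto simp: trivial_limit_def ev N_def)
    show "\<F> \<le> principal A"
      unfolding le_principal ev using \<open>topspace ?W \<in> N\<close> by blast
    fix \<phi> assume \<phi>: "\<phi> \<in> vcarrier (dual X)"
    show "((\<lambda>x. \<phi> x) \<longlongrightarrow> F \<phi>) \<F>"
    proof (rule topological_tendstoI)
      fix V :: "real set" assume V: "open V" "F \<phi> \<in> V"
      have "openin ?P {g \<in> topspace ?P. g \<phi> \<in> V}"
        using V(1) \<phi> by (intro openin_continuous_map_preimage[OF continuous_map_product_projection]) auto
      then have "openin ?W ((\<lambda>G. restrict G (vcarrier (dual X))) -` {g \<in> topspace ?P. g \<phi> \<in> V}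
          \<inter> vcarrier (bidual X))"
        unfolding weak_star_topology_def openin_pullback_topology by blast
      moreover have "(\<lambda>G. restrict G (vcarrier (dual X))) -` {g \<in> topspace ?P. g \<phi> \<in> V}
          \<inter> vcarrier (bidual X) = {G \<in> vcarrier (bidual X). G \<phi> \<in> V}"
        using \<phi> by auto
      ultimately have "{G \<in> vcarrier (bidual X). G \<phi> \<in> V} \<in> N"
        using F V by (simp add: N_def)
      then show "eventually (\<lambda>x. \<phi> x \<in> V) \<F>"
        unfolding ev using \<phi> by (intro bexI) (auto simp: canonical_embedding_def)
    qed
  qed
qed

lemma filter_imp_weak_star_closure:
  assumes A: "A \<subseteq> vcarrier X" and F: "F \<in> vcarrier (bidual X)"
    and \<F>: "\<F> \<noteq> bot" "\<F> \<le> principal A"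
    and lim: "\<And>\<phi>. \<phi> \<in> vcarrier (dual X) \<Longrightarrow> ((\<lambda>x. \<phi> x) \<longlongrightarrow> F \<phi>) \<F>"
  shows "F \<in> weak_star_topology (dual X) closure_of (canonical_embedding X ` A)"
proof -
  let ?W = "weak_star_topology (dual X)"
  let ?P = "product_topology (\<lambda>_. euclideanreal) (vcarrier (dual X))"
  let ?r = "\<lambda>G. restrict G (vcarrier (dual X))"
  have lim': "limitin ?P (\<lambda>x. ?r (canonical_embedding X x)) (?r F) \<F>"
    using lim by (auto simp: limitin_componentwise canonical_embedding_def)
  have "\<exists>x\<in>A. canonical_embedding X x \<in> U" if U: "openin ?W U" "F \<in> U" for U
  proof -
    obtain V where V: "openin ?P V" "U = ?r -` V \<inter> vcarrier (bidual X)"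
      using U unfolding weak_star_topology_def openin_pullback_topology by blast
    then have "eventually (\<lambda>x. ?r (canonical_embedding X x) \<in> V) \<F>"
      using lim' U(2) by (auto simp: limitin_def)
    moreover have "eventually (\<lambda>x. x \<in> A) \<F>"
      using \<F>(2) by (simp add: le_principal)
    ultimately have "eventually (\<lambda>x. x \<in> A \<and> ?r (canonical_embedding X x) \<in> V) \<F>"
      by eventually_elim simp
    then obtain x where "x \<in> A" "?r (canonical_embedding X x) \<in> V"
      using eventually_happens'[OF \<F>(1)] by blast
    then show ?thesis
      using A canonical_embedding_in_bidual V by blast
  qed
  then show ?thesis
    using F by (auto simp: in_closure_of weak_star_topology_def topspace_pullback_topology)
qed

lemma limit_in_bidual:
  assumes \<F>: "\<F> \<noteq> bot" and bdd: "eventually (\<lambda>i. u i \<in> vcarrier X \<and> vnorm X (u i) \<le> C) \<F>"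
    and lim: "\<And>\<phi>. \<phi> \<in> vcarrier (dual X) \<Longrightarrow> ((\<lambda>i. \<phi> (u i)) \<longlongrightarrow> F \<phi>) \<F>"
    and off: "\<And>\<phi>. \<phi> \<notin> vcarrier (dual X) \<Longrightarrow> F \<phi> = 0"
  shows "F \<in> vcarrier (bidual X)"
proof (rule functionalI[where C = C])
  fix \<phi> assume \<phi>: "\<phi> \<in> vcarrier (dual X)"
  show "F (vscale (dual X) c \<phi>) = c * F \<phi>" for c
    using tendsto_unique[OF \<F> lim[OF dual_scale_closed[OF \<phi>]] tendsto_mult_left[OF lim[OF \<phi>]]]
    by simp
  show "F (vadd (dual X) \<phi> \<psi>) = F \<phi> + F \<psi>" if \<psi>: "\<psi> \<in> vcarrier (dual X)" for \<psi>
    using tendsto_unique[OF \<F> lim[OF dual_add_closed[OF \<phi> \<psi>]] tendsto_add[OF lim[OF \<phi>] lim[OF \<psi>]]]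
    by simp
  have "eventually (\<lambda>i. \<bar>\<phi> (u i)\<bar> \<le> C * vnorm (dual X) \<phi>) \<F>"
    using bdd by eventually_elim (auto intro: functional_le_of_norm_le[OF \<phi>])
  then show "\<bar>F \<phi>\<bar> \<le> C * vnorm (dual X) \<phi>"
    by (rule tendsto_upperbound[OF tendsto_rabs[OF lim[OF \<phi>]] _ \<F>])
qed (fact off)

text \<open>
The Banach-Alaoglu theorem for the bidual.
\<close>

lemma bounded_filter_has_cluster_point:
  assumes \<F>: "\<F> \<noteq> bot" and bdd: "eventually (\<lambda>i. u i \<in> vcarrier X \<and> vnorm X (u i) \<le> C) \<F>"
  obtains \<G> F where "\<G> \<le> \<F>" "\<G> \<noteq> bot" "F \<in> vcarrier (bidual X)"
    "\<And>\<phi>. \<phi> \<in> vcarrier (dual X) \<Longrightarrow> ((\<lambda>i. \<phi> (u i)) \<longlongrightarrow> F \<phi>) \<G>"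
proof -
  interpret D: homogeneous_norm "dual X" by (rule homogeneous_norm_dual)
  have "eventually (\<lambda>i. \<bar>canonical_embedding X (u i) \<phi>\<bar> \<le> C * \<bar>vnorm (dual X) \<phi>\<bar>) \<F>" for \<phi>
    using bdd
  proof eventually_elim
    case (elim i)
    then have C: "C \<ge> 0" using norm_nonneg[of "u i"] by linarith
    have "\<bar>\<phi> (u i)\<bar> \<le> C * \<bar>vnorm (dual X) \<phi>\<bar>" if \<phi>: "\<phi> \<in> vcarrier (dual X)"
      using functional_le_of_norm_le[OF \<phi>, of "u i" C] elim D.norm_nonneg[OF \<phi>] by simp
    then show ?case using C by (simp add: canonical_embedding_def)
  qed
  from \<F> this obtain \<G> F where G: "\<G> \<le> \<F>" "\<G> \<noteq> bot"
    and lim: "\<And>\<phi>. ((\<lambda>i. canonical_embedding X (u i) \<phi>) \<longlongrightarrow> F \<phi>) \<G>"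
    by (rule tychonoff_filter[where h = "\<lambda>i. canonical_embedding X (u i)"]) (rule that)
  have lim': "((\<lambda>i. \<phi> (u i)) \<longlongrightarrow> F \<phi>) \<G>" if "\<phi> \<in> vcarrier (dual X)" for \<phi>
    using lim[of \<phi>] that by (simp add: canonical_embedding_def)
  have "F \<phi> = 0" if "\<phi> \<notin> vcarrier (dual X)" for \<phi>
    using lim[of \<phi>] that G(2) by (simp add: canonical_embedding_def tendsto_const_iff)
  with lim' have "F \<in> vcarrier (bidual X)"
    by (rule limit_in_bidual[OF G(2) filter_leD[OF G(1) bdd]])
  with G show thesis using lim' by (rule that)
qed

end

section \<open>Rosenthal's disjointification lemma\<close>

text \<open>
Split \<open>N\<close> into infinitely many infinite sets \<open>P p\<close>. If none of them satisfies the claim, each contains an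
index \<open>k p\<close> whose row has off-diagonal mass more than \<open>\<epsilon>\<close> inside \<open>P p\<close>. The set of all \<open>k p\<close> meets \<open>P p\<close>
only in \<open>k p\<close>, so on this set the row sums have dropped by \<open>\<epsilon>\<close>. This can happen at most \<open>m\<close> times.
\<close>

lemma rosenthal_aux:
  fixes a :: "nat \<Rightarrow> nat \<Rightarrow> real"
  assumes "infinite N" "\<And>k j. 0 \<le> a k j" "0 \<le> \<epsilon>"
    and "\<And>k F. k \<in> N \<Longrightarrow> finite F \<Longrightarrow> F \<subseteq> N \<Longrightarrow> (\<Sum>j\<in>F. a k j) \<le> real m * \<epsilon>"
  shows "\<exists>S\<subseteq>N. infinite S \<and> (\<forall>k\<in>S. \<forall>F. finite F \<longrightarrow> F \<subseteq> S - {k} \<longrightarrow> (\<Sum>j\<in>F. a k j) \<le> \<epsilon>)"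
  using assms
proof (induction m arbitrary: N)
  case 0
  have "(\<Sum>j\<in>F. a k j) \<le> \<epsilon>" if "k \<in> N" "finite F" "F \<subseteq> N - {k}" for k F
  proof -
    have "(\<Sum>j\<in>F. a k j) \<le> real 0 * \<epsilon>" using that by (intro "0.prems"(4)) blast+
    then show ?thesis using "0.prems"(3) by simp
  qed
  then show ?case using "0.prems"(1) by blast
next
  case (Suc m)
  show ?case
  proof (rule ccontr)
    assume no: "\<not> ?thesis"
    \<comment> \<open>The pairing function arranges the elements of \<open>N\<close> in a matrix, whose rows are the \<open>P p\<close>.\<close>
    define P where "P p = (\<lambda>q. enumerate N (prod_encode (p, q))) ` UNIV" for p
    have inj: "inj (enumerate N)"
      using strict_mono_enumerate[OF Suc.prems(1)] strict_mono_imp_inj_on by blast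
    have PN: "P p \<subseteq> N" for p
      using enumerate_in_set[OF Suc.prems(1)] by (auto simp: P_def)
    have Pinf: "infinite (P p)" for p
      unfolding P_def
      by (intro range_inj_infinite injI) (use inj in \<open>auto dest!: injD\<close>)
    have Pdisj: "p = q" if "x \<in> P p" "x \<in> P q" for p q x
      using that inj by (auto simp: P_def dest!: injD)
    have "\<exists>k\<in>P p. \<exists>F. finite F \<and> F \<subseteq> P p - {k} \<and> (\<Sum>j\<in>F. a k j) > \<epsilon>" for p
      using no PN[of p] Pinf[of p] by (meson not_le)
    then obtain k F where k: "\<And>p. k p \<in> P p" and F: "\<And>p. finite (F p)" "\<And>p. F p \<subseteq> P p - {k p}"
      and large: "\<And>p. (\<Sum>j\<in>F p. a (k p) j) > \<epsilon>"
      by metis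
    have "inj k" using k Pdisj by (metis injI)
    then have "infinite (range k)" by (rule range_inj_infinite)
    moreover have KN: "range k \<subseteq> N" using k PN by auto
    moreover have "(\<Sum>j\<in>G. a i j) \<le> real m * \<epsilon>"
      if i: "i \<in> range k" and G: "finite G" "G \<subseteq> range k" for i G
    proof -
      obtain p where p: "i = k p" using i by auto
      have "G \<inter> F p = {}" using G F(2)[of p] k Pdisj by blast
      then have "(\<Sum>j\<in>G. a i j) + (\<Sum>j\<in>F p. a i j) = (\<Sum>j\<in>G \<union> F p. a i j)"
        using G F by (simp add: sum.union_disjoint)
      also have "\<dots> \<le> real (Suc m) * \<epsilon>"
        using G F PN KN i by (intro Suc.prems(4)) blast+
      finally show ?thesis using large[of p] p by (simp add: distrib_right)
    qed
    ultimately obtain S where S: "S \<subseteq> range k" "infinite S"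
      "\<forall>k\<in>S. \<forall>F. finite F \<longrightarrow> F \<subseteq> S - {k} \<longrightarrow> (\<Sum>j\<in>F. a k j) \<le> \<epsilon>"
      using Suc.IH[OF _ Suc.prems(2,3), of "range k"] by auto
    from S(1) KN have "S \<subseteq> N" by (rule subset_trans)
    with S(2,3) no show False by metis
  qed
qed

lemma rosenthal:
  fixes a :: "nat \<Rightarrow> nat \<Rightarrow> real"
  assumes "infinite N" "\<And>k j. 0 \<le> a k j" "\<epsilon> > 0"
    and "\<And>k F. k \<in> N \<Longrightarrow> finite F \<Longrightarrow> (\<Sum>j\<in>F. a k j) \<le> C"
  obtains S where "S \<subseteq> N" "infinite S"
    "\<And>k F. k \<in> S \<Longrightarrow> finite F \<Longrightarrow> F \<subseteq> S - {k} \<Longrightarrow> (\<Sum>j\<in>F. a k j) \<le> \<epsilon>"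
proof -
  obtain m :: nat where "C / \<epsilon> \<le> real m" using real_arch_simple by blast
  then have "C \<le> real m * \<epsilon>" using \<open>\<epsilon> > 0\<close> by (simp add: field_simps)
  then have "(\<Sum>j\<in>F. a k j) \<le> real m * \<epsilon>" if "k \<in> N" "finite F" for k F
    using assms(4)[OF that] by linarith
  with rosenthal_aux[of N a \<epsilon> m] assms(1-3)
  obtain S where "S \<subseteq> N" "infinite S"
    "\<forall>k\<in>S. \<forall>F. finite F \<longrightarrow> F \<subseteq> S - {k} \<longrightarrow> (\<Sum>j\<in>F. a k j) \<le> \<epsilon>"
    by (metis less_imp_le)
  then show thesis by (intro that[of S]) auto
qed

section \<open>The lower bound for the measure of weak noncompactness\<close>

context homogeneous_norm
begin

lemma bidual_distance_ge:
  assumes F: "F \<in> vcarrier (bidual X)" and x: "x \<in> vcarrier X" and g: "g \<in> unit_ball (dual X)"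
  shows "F g - g x \<le> vnorm (bidual X) (vdiff (bidual X) F (canonical_embedding X x))"
proof -
  interpret D: homogeneous_norm "dual X" by (rule homogeneous_norm_dual)
  let ?G = "vdiff (bidual X) F (canonical_embedding X x)"
  have "?G \<in> vcarrier (bidual X)"
    using D.dual_add_closed[OF F D.dual_scale_closed[OF canonical_embedding_in_bidual[OF x], of "-1"]]
    by (simp add: vdiff_def)
  from D.functional_le_on_unit_ball[OF this g] have "\<bar>?G g\<bar> \<le> vnorm (bidual X) ?G" .
  moreover have "?G g = F g - g x"
    using g by (simp add: vdiff_def canonical_embedding_def unit_ball_def)
  ultimately show ?thesis by linarith
qed

lemma weakly_summable_series_in_unit_ball:
  assumes f: "\<And>n. f n \<in> vcarrier (dual X)"
    and le: "\<And>(n::nat) x. x \<in> vcarrier X \<Longrightarrow> (\<Sum>k<n. \<bar>f k x\<bar>) \<le> vnorm X x"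
    and \<sigma>: "\<And>n. \<bar>\<sigma> n\<bar> \<le> (1::real)"
  shows "(\<lambda>x. \<Sum>n. \<sigma> n * f n x) \<in> unit_ball (dual X)"
    and "\<And>x. x \<in> vcarrier X \<Longrightarrow> summable (\<lambda>n. \<sigma> n * f n x)"
proof -
  let ?g = "\<lambda>x. \<Sum>n. \<sigma> n * f n x"
  have term_le: "\<bar>\<sigma> n * f n x\<bar> \<le> \<bar>f n x\<bar>" for n x
    using mult_right_mono[OF \<sigma>[of n], of "\<bar>f n x\<bar>"] by (simp add: abs_mult)
  have "(\<Sum>k<n. \<bar>\<sigma> k * f k x\<bar>) \<le> vnorm X x" if "x \<in> vcarrier X" for n x
    using sum_mono[of "{..<n}" "\<lambda>k. \<bar>\<sigma> k * f k x\<bar>" "\<lambda>k. \<bar>f k x\<bar>"] term_le le[OF that, of n]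
    by auto
  note * = partial_sums_bounded_imp_suminf_le[OF _ this, simplified]
  show sm: "summable (\<lambda>n. \<sigma> n * f n x)" if "x \<in> vcarrier X" for x
    using *(1)[OF that] by (rule summable_rabs_cancel)
  have bd: "\<bar>?g x\<bar> \<le> 1 * vnorm X x" if "x \<in> vcarrier X" for x
    using summable_rabs[OF *(1)[OF that]] *(2)[OF that] by simp
  have "?g \<in> vcarrier (dual X)"
  proof (rule functionalI[OF _ _ _ bd])
    show "?g x = 0" if "x \<notin> vcarrier X" for x
      using functional_off_carrier[OF f that] by simp
    show "?g (vadd X x y) = ?g x + ?g y" if "x \<in> vcarrier X" "y \<in> vcarrier X" for x y
      using suminf_add[OF sm sm] that functional_add[OF f that] by (simp add: distrib_left)
    show "?g (vscale X c x) = c * ?g x" if "x \<in> vcarrier X" for c x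
      using suminf_mult[OF sm[OF that], of c] functional_scale[OF f that] by (simp add: mult.left_commute)
  qed
  moreover have "vnorm (dual X) ?g \<le> 1"
    using bd by (intro dual_norm_le) (force simp: unit_ball_def)
  ultimately show "?g \<in> unit_ball (dual X)" by (simp add: unit_ball_def)
qed

text \<open>
A gliding hump: the functionals \<open>g m\<close> are bounded below by \<open>d\<close> at the limit \<open>F\<close>, while they vanish in the
limit at each point of \<open>X\<close>. The slack \<open>c - d\<close> absorbs the off-diagonal terms.
\<close>

lemma far_cluster_point:
  assumes A: "bounded_subset X A"
    and f: "weakly_1_summable (dual X) f" "weak_1_norm (dual X) f \<le> 1"
    and N: "infinite N" "\<And>n. n \<in> N \<Longrightarrow> \<exists>x\<in>A. c < \<bar>f n x\<bar>" and dc: "d < c"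
  obtains F where "F \<in> weak_star_topology (dual X) closure_of (canonical_embedding X ` A)"
    "\<And>x. x \<in> vcarrier X \<Longrightarrow> d \<le> vnorm (bidual X) (vdiff (bidual X) F (canonical_embedding X x))"
proof -
  have fd: "f n \<in> vcarrier (dual X)" for n
    using f by (auto simp: weakly_1_summable_def)
  note fle = sum_le_if_weak_1_norm_le_1[OF f]
  obtain B where AX: "A \<subseteq> vcarrier X" and B: "\<And>x. x \<in> A \<Longrightarrow> vnorm X x \<le> B"
    using A by (auto simp: bounded_subset_def)
  obtain u where u: "\<And>n. n \<in> N \<Longrightarrow> u n \<in> A" "\<And>n. n \<in> N \<Longrightarrow> c < \<bar>f n (u n)\<bar>"
    using N(2) by metis
  have "(\<Sum>j\<in>J. \<bar>f j (u k)\<bar>) \<le> B" if "k \<in> N" "finite J" for k J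
    using fle[OF _ that(2), of "u k"] B[OF u(1)[OF that(1)]] u(1)[OF that(1)] AX by force
  with N(1) dc obtain S where S: "S \<subseteq> N" "infinite S"
    and off_diag: "\<And>k J. k \<in> S \<Longrightarrow> finite J \<Longrightarrow> J \<subseteq> S - {k} \<Longrightarrow> (\<Sum>j\<in>J. \<bar>f j (u k)\<bar>) \<le> c - d"
    by (elim rosenthal[of N "\<lambda>k j. \<bar>f j (u k)\<bar>" "c - d" B]) auto
  define \<sigma> where "\<sigma> n = (if n \<in> S then sgn (f n (u n)) else 0)" for n
  define g where "g m x = (\<Sum>n. \<sigma> (n + m) * f (n + m) x)" for m x
  have \<sigma>: "\<bar>\<sigma> n\<bar> \<le> 1" for n by (auto simp: \<sigma>_def sgn_if)
  have tail_le: "(\<Sum>k<n. \<bar>f (k + m) x\<bar>) \<le> vnorm X x" if "x \<in> vcarrier X" for n m x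
    using fle[OF that, of "{m..<n + m}"] sum.shift_bounds_nat_ivl[of "\<lambda>k. \<bar>f k x\<bar>" 0 m n]
    by (simp add: atLeast0LessThan)
  have g_series: "(\<lambda>x. \<Sum>n. \<sigma> (n + m) * f (n + m) x) \<in> unit_ball (dual X)" for m
    by (rule weakly_summable_series_in_unit_ball(1)[OF fd tail_le \<sigma>])
  have g_summable: "summable (\<lambda>n. \<sigma> (n + m) * f (n + m) x)" if "x \<in> vcarrier X" for m x
    by (rule weakly_summable_series_in_unit_ball(2)[OF fd tail_le \<sigma> that])
  have g_ball: "g m \<in> unit_ball (dual X)" for m
    using g_series[of m] by (simp add: g_def[abs_def])
  have g_tendsto: "(\<lambda>m. g m x) \<longlonglongrightarrow> 0" if "x \<in> vcarrier X" for x
    unfolding g_def using g_summable[OF that, of 0] by (intro suminf_tail_tendsto_0[of "\<lambda>n. \<sigma> n * f n x"]) simp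
  have g_large: "d \<le> g m (u k)" if k: "k \<in> S" "m \<le> k" for m k
  proof -
    have ukX: "u k \<in> vcarrier X" using u(1) S(1) k AX by blast
    let ?t = "\<lambda>j. \<sigma> j * f j (u k)"
    have "d \<le> (\<Sum>j<n. \<sigma> (j + m) * f (j + m) (u k))" if n: "n > k" for n
    proof -
      let ?J = "{m..<n + m} - {k}"
      have "(\<Sum>j<n. \<sigma> (j + m) * f (j + m) (u k)) = (\<Sum>j\<in>{m..<n + m}. ?t j)"
        using sum.shift_bounds_nat_ivl[of ?t 0 m n] by (simp add: atLeast0LessThan)
      also have "\<dots> = ?t k + (\<Sum>j\<in>?J. ?t j)"
        using k n by (intro sum.remove) auto
      finally have eq: "(\<Sum>j<n. \<sigma> (j + m) * f (j + m) (u k)) = ?t k + (\<Sum>j\<in>?J. ?t j)" .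
      have "?t k > c" using u(2) S(1) k by (auto simp: \<sigma>_def abs_sgn mult.commute)
      moreover have "\<bar>\<Sum>j\<in>?J. ?t j\<bar> \<le> c - d"
      proof -
        have "\<bar>\<Sum>j\<in>?J. ?t j\<bar> \<le> (\<Sum>j\<in>?J. \<bar>?t j\<bar>)" by (rule sum_abs)
        also have "\<dots> = (\<Sum>j\<in>?J \<inter> S. \<bar>?t j\<bar>)"
          by (intro sum.mono_neutral_right) (auto simp: \<sigma>_def)
        also have "\<dots> \<le> (\<Sum>j\<in>?J \<inter> S. \<bar>f j (u k)\<bar>)"
          by (intro sum_mono) (auto simp: \<sigma>_def abs_mult sgn_if)
        also have "\<dots> \<le> c - d" using k by (intro off_diag) auto
        finally show ?thesis .
      qed
      ultimately show ?thesis using eq by linarith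
    qed
    then show ?thesis
      unfolding g_def by (intro LIMSEQ_le_const[OF summable_LIMSEQ[OF g_summable[OF ukX]]] exI[of _ "Suc k"]) auto
  qed
  \<comment> \<open>Only the indices in \<open>S\<close> may survive in the limit, since \<open>g m\<close> is controlled at these \<open>u k\<close> alone.\<close>
  define \<F> where "\<F> = inf sequentially (principal S)"
  have evF: "eventually P \<F> \<longleftrightarrow> (\<exists>m. \<forall>k\<ge>m. k \<in> S \<longrightarrow> P k)" for P
    by (simp add: \<F>_def eventually_inf_principal eventually_sequentially)
  have "\<F> \<noteq> bot"
    using S(2) by (auto simp: trivial_limit_def evF infinite_nat_iff_unbounded_le)
  moreover have "eventually (\<lambda>k. u k \<in> vcarrier X \<and> vnorm X (u k) \<le> B) \<F>"
    unfolding evF using u(1) S(1) AX B by blast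
  ultimately obtain \<G> F where G: "\<G> \<le> \<F>" "\<G> \<noteq> bot" and F: "F \<in> vcarrier (bidual X)"
    and lim: "\<And>\<phi>. \<phi> \<in> vcarrier (dual X) \<Longrightarrow> ((\<lambda>k. \<phi> (u k)) \<longlongrightarrow> F \<phi>) \<G>"
    by (rule bounded_filter_has_cluster_point) blast
  have "F \<in> weak_star_topology (dual X) closure_of (canonical_embedding X ` A)"
  proof (rule filter_imp_weak_star_closure[OF AX F, of "filtermap u \<G>"])
    have "eventually (\<lambda>k. u k \<in> A) \<F>" unfolding evF using u(1) S(1) by blast
    then show "filtermap u \<G> \<le> principal A"
      using filter_leD[OF G(1)] by (simp add: le_principal eventually_filtermap)
  qed (use G lim in \<open>auto simp: filtermap_bot_iff filterlim_filtermap\<close>)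
  moreover have "d \<le> vnorm (bidual X) (vdiff (bidual X) F (canonical_embedding X x))"
    if x: "x \<in> vcarrier X" for x
  proof -
    let ?D = "vnorm (bidual X) (vdiff (bidual X) F (canonical_embedding X x))"
    have "d \<le> F (g m)" for m
    proof (rule tendsto_lowerbound[OF lim _ G(2)])
      show "g m \<in> vcarrier (dual X)" using g_ball by (simp add: unit_ball_def)
      show "eventually (\<lambda>k. d \<le> g m (u k)) \<G>"
        using g_large by (intro filter_leD[OF G(1)]) (auto simp: evF)
    qed
    then have "d - g m x \<le> ?D" for m
      using bidual_distance_ge[OF F x g_ball, of m] by (smt (verit))
    moreover have "(\<lambda>m. d - g m x) \<longlonglongrightarrow> d - 0"
      by (intro tendsto_diff tendsto_const g_tendsto x)
    ultimately show ?thesis by (intro LIMSEQ_le_const2[of "\<lambda>m. d - g m x" d]) auto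
  qed
  ultimately show thesis by (rule that)
qed

theorem iota1_le_wk:
  assumes A: "bounded_subset X A"
  shows "iota1 X A \<le> wk X A"
  unfolding iota1_def
proof (rule SUP_least, clarify, rule ccontr)
  fix f assume f: "weakly_1_summable (dual X) f" "weak_1_norm (dual X) f \<le> 1"
    and "\<not> limsup (\<lambda>n. SUP x\<in>A. ennreal \<bar>f n x\<bar>) \<le> wk X A"
  then have "wk X A < limsup (\<lambda>n. SUP x\<in>A. ennreal \<bar>f n x\<bar>)" by simp
  \<comment> \<open>Two intermediate values, because Rosenthal's lemma costs an arbitrarily small amount.\<close>
  then obtain d' where d': "wk X A < d'" "d' < limsup (\<lambda>n. SUP x\<in>A. ennreal \<bar>f n x\<bar>)"
    using dense by blast
  then obtain c' where c': "d' < c'" "c' < limsup (\<lambda>n. SUP x\<in>A. ennreal \<bar>f n x\<bar>)"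
    using dense by blast
  obtain c where c: "c' = ennreal c" "0 \<le> c" using c' by (cases c') auto
  obtain d where d: "d' = ennreal d" "0 \<le> d" using c' by (cases d') auto
  define N where "N = {n. \<exists>x\<in>A. c < \<bar>f n x\<bar>}"
  have N: "\<exists>x\<in>A. c < \<bar>f n x\<bar>" if "n \<in> N" for n using that by (simp add: N_def)
  have "infinite N"
  proof
    assume "finite N"
    then obtain m where m: "\<forall>n\<in>N. n < m" using finite_nat_set_iff_bounded[of N] by auto
    then have "\<bar>f n x\<bar> \<le> c" if "m \<le> n" "x \<in> A" for n x
      using that by (auto simp: N_def not_less[symmetric])
    then have "eventually (\<lambda>n. (SUP x\<in>A. ennreal \<bar>f n x\<bar>) \<le> ennreal c) sequentially"
      unfolding eventually_sequentially
      by (intro exI[of _ m] allI impI SUP_least ennreal_leI)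
    then have "limsup (\<lambda>n. SUP x\<in>A. ennreal \<bar>f n x\<bar>) \<le> ennreal c" by (rule Limsup_bounded)
    then show False using c' c by simp
  qed
  moreover have "d < c" using c' c d by (simp add: ennreal_less_iff)
  ultimately obtain F where F: "F \<in> weak_star_topology (dual X) closure_of (canonical_embedding X ` A)"
    "\<And>x. x \<in> vcarrier X \<Longrightarrow> d \<le> vnorm (bidual X) (vdiff (bidual X) F (canonical_embedding X x))"
    using far_cluster_point[OF A f _ N] by metis
  have "ennreal d \<le> dist_to_space X F"
    unfolding dist_to_space_def using F(2) by (intro INF_greatest ennreal_leI)
  also have "\<dots> \<le> wk X A"
    unfolding wk_def by (rule SUP_upper[OF F(1)])
  finally show False using d' d by simp
qed

end

section \<open>Continuous functionals for the norm of mean convergence\<close>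

text \<open>
Adding \<open>K\<close> times the measure to \<open>\<nu>\<close> gives a nonnegative set function, and its domination by \<open>2 * K\<close> times a finite measure
makes it continuous at the empty set. Hence finite additivity already implies countable additivity, and the
Radon-Nikodym theorem for positive measures applies without a Jordan decomposition.
\<close>

lemma bounded_additive_set_function_density:
  fixes \<nu> :: "'b set \<Rightarrow> real"
  assumes "finite_measure M"
    and add: "\<And>A B. A \<in> sets M \<Longrightarrow> B \<in> sets M \<Longrightarrow> A \<inter> B = {} \<Longrightarrow> \<nu> (A \<union> B) = \<nu> A + \<nu> B"
    and le: "\<And>A. A \<in> sets M \<Longrightarrow> \<bar>\<nu> A\<bar> \<le> K * measure M A"
  obtains y where "y \<in> borel_measurable M" "AE x in M. \<bar>y x\<bar> \<le> K"
    "\<And>A. A \<in> sets M \<Longrightarrow> \<nu> A = (\<integral>x. y x * indicator A x \<partial>M)"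
proof -
  interpret finite_measure M by fact
  define \<rho> where "\<rho> A = \<nu> A + K * measure M A" for A
  have \<rho>0: "0 \<le> \<rho> A" and \<rho>le: "\<rho> A \<le> 2 * K * measure M A" if "A \<in> sets M" for A
    using le[OF that] by (auto simp: \<rho>_def)
  have \<rho>add: "\<rho> (A \<union> B) = \<rho> A + \<rho> B" if "A \<in> sets M" "B \<in> sets M" "A \<inter> B = {}" for A B
    using add[OF that] finite_measure_Union[OF that] by (simp add: \<rho>_def algebra_simps)
  have "\<rho> {} = 0" using \<rho>0[of "{}"] \<rho>le[of "{}"] by simp
  define N where "N = measure_of (space M) (sets M) (\<lambda>A. ennreal (\<rho> A))"
  have pos: "positive (sets M) (\<lambda>A. ennreal (\<rho> A))"
    using \<open>\<rho> {} = 0\<close> by (simp add: positive_def)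
  have "countably_additive (sets M) (\<lambda>A. ennreal (\<rho> A))"
  proof (rule sets.empty_continuous_imp_countably_additive[OF pos])
    show "additive (sets M) (\<lambda>A. ennreal (\<rho> A))"
      using \<rho>add \<rho>0 by (simp add: additive_def)
    fix A :: "nat \<Rightarrow> 'b set" assume A: "range A \<subseteq> sets M" "decseq A" "(\<Inter>i. A i) = {}"
    have m: "(\<lambda>i. measure M (A i)) \<longlonglongrightarrow> 0"
      using finite_Lim_measure_decseq[OF A(1,2)] A(3) by simp
    have "(\<lambda>i. \<rho> (A i)) \<longlonglongrightarrow> 0"
    proof (rule tendsto_sandwich[OF _ _ tendsto_const])
      show "(\<lambda>i. 2 * K * measure M (A i)) \<longlonglongrightarrow> 0"
        using tendsto_mult_left[OF m, of "2 * K"] by simp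
    qed (use A(1) \<rho>0 \<rho>le in \<open>auto intro!: always_eventually\<close>)
    then show "(\<lambda>i. ennreal (\<rho> (A i))) \<longlonglongrightarrow> 0"
      using tendsto_ennrealI by fastforce
  qed simp
  then have N: "emeasure N A = ennreal (\<rho> A)" if "A \<in> sets M" for A
    unfolding N_def using pos that by (intro emeasure_measure_of_sigma) (auto simp: sets.sigma_algebra_axioms)
  have sN: "sets N = sets M" by (simp add: N_def)
  then have spN: "space N = space M" by (rule sets_eq_imp_space_eq)
  have fN: "finite_measure N"
    by (rule finite_measureI) (simp add: spN N)
  have ac: "absolutely_continuous M N"
  proof -
    have "A \<in> null_sets N" if A: "A \<in> null_sets M" for A
    proof -
      have "A \<in> sets M" "measure M A = 0" using A by (auto simp: measure_def)
      then have "\<rho> A = 0" using \<rho>0[of A] \<rho>le[of A] by simp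
      then show ?thesis using \<open>A \<in> sets M\<close> by (simp add: null_sets_def sN N)
    qed
    then show ?thesis by (auto simp: absolutely_continuous_def)
  qed
  obtain D where D[measurable]: "D \<in> borel_measurable M"
    and DRN: "AE x in M. RN_deriv M N x = ennreal (D x)" and D0: "\<And>x. 0 \<le> D x"
    using real_RN_deriv[OF fN ac sN] by metis
  have int: "integrable M (\<lambda>x. D x * indicator A x)"
    and eq: "(\<integral>x. D x * indicator A x \<partial>M) = \<rho> A" if [measurable]: "A \<in> sets M" for A
  proof -
    have "emeasure N A = emeasure (density M (RN_deriv M N)) A"
      using density_RN_deriv[OF ac sN] by simp
    also have "\<dots> = (\<integral>\<^sup>+x. RN_deriv M N x * indicator A x \<partial>M)"
      by (simp add: emeasure_density)
    also have "\<dots> = (\<integral>\<^sup>+x. ennreal (D x * indicator A x) \<partial>M)"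
      using DRN by (intro nn_integral_cong_AE) (auto elim!: eventually_mono simp: indicator_def)
    finally have nn: "(\<integral>\<^sup>+x. ennreal (D x * indicator A x) \<partial>M) = ennreal (\<rho> A)"
      using N[OF that] by simp
    show "integrable M (\<lambda>x. D x * indicator A x)"
      using nn D0 by (intro integrableI_nonneg) auto
    show "(\<integral>x. D x * indicator A x \<partial>M) = \<rho> A"
      using nn D0 \<rho>0[OF that] by (subst integral_eq_nn_integral) auto
  qed
  have iD: "integrable M D"
    using int[of "space M"] by (rule Bochner_Integration.integrable_cong[THEN iffD1, rotated 2]) auto
  define y where "y x = D x - K" for x
  have [measurable]: "y \<in> borel_measurable M" unfolding y_def by measurable
  have iy: "integrable M (\<lambda>x. y x * indicator A x)"
    and yeq: "\<nu> A = (\<integral>x. y x * indicator A x \<partial>M)" if "A \<in> sets M" for A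
  proof -
    have [simp]: "(\<lambda>x. y x * indicator A x) = (\<lambda>x. D x * indicator A x - K * indicator A x)"
      by (simp add: y_def left_diff_distrib)
    show "integrable M (\<lambda>x. y x * indicator A x)"
      using int[OF that] that by (simp add: less_top[symmetric])
    show "\<nu> A = (\<integral>x. y x * indicator A x \<partial>M)"
      using int[OF that] that eq[OF that]
      by (simp add: less_top[symmetric] \<rho>_def)
  qed
  \<comment> \<open>On \<open>P = {y > K}\<close> the integral of the nonnegative \<open>y - K\<close> equals \<open>\<nu> P - K * measure M P \<le> 0\<close>; the
    lower bound \<open>- K\<close> is the nonnegativity of \<open>D\<close>.\<close>
  have upper: "AE x in M. y x \<le> K"
  proof -
    define P where "P = {x \<in> space M. K < y x}"
    have [measurable]: "P \<in> sets M" unfolding P_def by measurable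
    have "integrable M (\<lambda>x. y x * indicator P x - K * indicator P x)"
      using iy[of P] by (simp add: less_top[symmetric])
    then have i: "integrable M (\<lambda>x. (y x - K) * indicator P x)" by (simp add: left_diff_distrib)
    have "(\<integral>x. (y x - K) * indicator P x \<partial>M) = \<nu> P - K * measure M P"
      using iy[of P] yeq[of P] by (simp add: left_diff_distrib less_top[symmetric])
    also have "\<dots> \<le> 0" using le[of P] by simp
    finally have "(\<integral>x. (y x - K) * indicator P x \<partial>M) = 0"
      by (intro antisym integral_nonneg_AE) (auto simp: P_def indicator_def)
    then have "AE x in M. (y x - K) * indicator P x = 0"
      using i by (subst (asm) integral_nonneg_eq_0_iff_AE) (auto simp: P_def indicator_def)
    then show ?thesis using AE_space by eventually_elim (auto simp: P_def indicator_def split: if_splits)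
  qed
  have "AE x in M. \<bar>y x\<bar> \<le> K"
    using upper by eventually_elim (use D0 in \<open>auto simp: y_def abs_le_iff\<close>)
  with \<open>y \<in> borel_measurable M\<close> show thesis using yeq by (rule that)
qed

text \<open>
Simple functions are dense in mean. The domain \<open>S\<close> is a parameter because the lemma serves twice: for
functionals on all integrable functions and for functionals on the bounded measurable ones.
\<close>

lemma L1_continuous_functional_eq_0:
  fixes \<Lambda> :: "('b \<Rightarrow> real) \<Rightarrow> real"
  assumes int: "\<And>f. f \<in> S \<Longrightarrow> integrable M f"
    and simple: "\<And>f. simple_function M f \<Longrightarrow> f \<in> S"
    and S_add: "\<And>f g. f \<in> S \<Longrightarrow> g \<in> S \<Longrightarrow> (\<lambda>x. f x + g x) \<in> S"
    and S_scale: "\<And>c f. f \<in> S \<Longrightarrow> (\<lambda>x. c * f x) \<in> S"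
    and add: "\<And>f g. f \<in> S \<Longrightarrow> g \<in> S \<Longrightarrow> \<Lambda> (\<lambda>x. f x + g x) = \<Lambda> f + \<Lambda> g"
    and scale: "\<And>c f. f \<in> S \<Longrightarrow> \<Lambda> (\<lambda>x. c * f x) = c * \<Lambda> f"
    and le: "\<And>f. f \<in> S \<Longrightarrow> \<bar>\<Lambda> f\<bar> \<le> K * (\<integral>x. \<bar>f x\<bar> \<partial>M)"
    and zero: "\<And>A. A \<in> sets M \<Longrightarrow> \<Lambda> (indicator A) = 0"
    and f: "f \<in> S"
  shows "\<Lambda> f = 0"
proof -
  have diff: "(\<lambda>x. f x - g x) \<in> S" "\<Lambda> (\<lambda>x. f x - g x) = \<Lambda> f - \<Lambda> g" if "f \<in> S" "g \<in> S" for f g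
    using S_add[OF that(1) S_scale[OF that(2)], of "-1"] add[OF that(1) S_scale[OF that(2)], of "-1"]
      scale[OF that(2), of "-1"] by simp_all
  have ae: "\<Lambda> f = \<Lambda> g" if "f \<in> S" "g \<in> S" "\<And>x. x \<in> space M \<Longrightarrow> f x = g x" for f g
  proof -
    have "(\<integral>x. \<bar>f x - g x\<bar> \<partial>M) = (\<integral>x. 0 \<partial>M)"
      using that by (intro Bochner_Integration.integral_cong) auto
    then have "\<bar>\<Lambda> f - \<Lambda> g\<bar> \<le> 0" using le[OF diff(1)[OF that(1,2)]] diff(2)[OF that(1,2)] by simp
    then show ?thesis by simp
  qed
  have ind: "(\<lambda>x. v * indicator A x) \<in> S" "\<Lambda> (\<lambda>x. v * indicator A x) = 0" if "A \<in> sets M" for v A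
  proof -
    have "indicator A \<in> S" using that by (intro simple) simp
    then show "(\<lambda>x. v * indicator A x) \<in> S" "\<Lambda> (\<lambda>x. v * indicator A x) = 0"
      using S_scale scale zero that by auto
  qed
  have sums: "(\<lambda>x. \<Sum>v\<in>V. v * indicator (A v) x) \<in> S \<and> \<Lambda> (\<lambda>x. \<Sum>v\<in>V. v * indicator (A v) x) = 0"
    if "finite V" "\<And>v. v \<in> V \<Longrightarrow> A v \<in> sets M" for V A
    using that
  proof (induction V)
    case empty
    then show ?case using ind[of "{}" 0] by simp
  next
    case (insert v V)
    let ?s = "\<lambda>x. \<Sum>v\<in>V. v * indicator (A v) x"
    have v: "(\<lambda>x. v * indicator (A v) x) \<in> S" "\<Lambda> (\<lambda>x. v * indicator (A v) x) = 0"
      using ind[of "A v" v] insert.prems by auto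
    have s: "?s \<in> S" "\<Lambda> ?s = 0" using insert.IH insert.prems by auto
    have "(\<lambda>x. \<Sum>v\<in>insert v V. v * indicator (A v) x) = (\<lambda>x. v * indicator (A v) x + ?s x)"
      by (simp only: sum.insert[OF insert.hyps])
    then show ?case using S_add[OF v(1) s(1)] add[OF v(1) s(1)] v(2) s(2) by simp
  qed
  have sf: "\<Lambda> s = 0" if s: "simple_function M s" for s
  proof -
    let ?A = "\<lambda>v. s -` {v} \<inter> space M"
    have sums': "(\<lambda>x. \<Sum>v\<in>s ` space M. v * indicator (?A v) x) \<in> S"
      "\<Lambda> (\<lambda>x. \<Sum>v\<in>s ` space M. v * indicator (?A v) x) = 0"
      using sums[of "s ` space M" ?A] s by (auto simp: simple_function_def)
    have "s x = (\<Sum>v\<in>s ` space M. v * indicator (?A v) x)" if "x \<in> space M" for x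
    proof -
      have "(\<Sum>v\<in>s ` space M. v * indicator (?A v) x) = (\<Sum>v\<in>s ` space M. if s x = v then v else 0)"
        using that by (intro sum.cong) (auto simp: indicator_def)
      then show ?thesis using that s by (simp add: simple_function_def)
    qed
    then have "\<Lambda> s = \<Lambda> (\<lambda>x. \<Sum>v\<in>s ` space M. v * indicator (?A v) x)"
      by (intro ae simple s sums')
    then show ?thesis using sums' by simp
  qed
  have [measurable]: "f \<in> borel_measurable M" using int[OF f] by auto
  obtain s where s: "\<And>i. simple_function M (s i)"
    and s_props: "\<forall>x\<in>space M. (\<lambda>i. s i x) \<longlonglongrightarrow> f x" "\<forall>i. \<forall>x\<in>space M. dist (s i x) 0 \<le> 2 * dist (f x) 0"
    using borel_measurable_implies_sequence_metric[of f M 0] by auto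
  have lim: "(\<lambda>i. s i x) \<longlonglongrightarrow> f x" and dom: "\<bar>s i x\<bar> \<le> 2 * \<bar>f x\<bar>" if "x \<in> space M" for i x
    using s_props that by (auto simp: dist_real_def)
  have [measurable]: "s i \<in> borel_measurable M" for i using s by (rule borel_measurable_simple_function)
  have "(\<lambda>i. \<integral>x. \<bar>f x - s i x\<bar> \<partial>M) \<longlonglongrightarrow> (\<integral>x. 0 \<partial>M)"
  proof (rule integral_dominated_convergence[where w = "\<lambda>x. 3 * \<bar>f x\<bar>"])
    show "AE x in M. (\<lambda>i. \<bar>f x - s i x\<bar>) \<longlonglongrightarrow> 0"
    proof (rule AE_I2)
      fix x assume "x \<in> space M"
      from tendsto_rabs[OF tendsto_diff[OF tendsto_const lim[OF this], of "f x"]]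
      show "(\<lambda>i. \<bar>f x - s i x\<bar>) \<longlonglongrightarrow> 0" by simp
    qed
    show "AE x in M. norm \<bar>f x - s i x\<bar> \<le> 3 * \<bar>f x\<bar>" for i
      using dom[of _ i] by (intro AE_I2) (smt (verit) real_norm_def)
  qed (use int[OF f] in auto)
  then have "(\<lambda>i. K * (\<integral>x. \<bar>f x - s i x\<bar> \<partial>M)) \<longlonglongrightarrow> 0"
    using tendsto_mult_right_zero by fastforce
  moreover have "\<bar>\<Lambda> f\<bar> \<le> K * (\<integral>x. \<bar>f x - s i x\<bar> \<partial>M)" for i
    using le[OF diff(1)[OF f simple[OF s[of i]]]] diff(2)[OF f simple[OF s[of i]]] sf[OF s[of i]] by simp
  ultimately have "\<bar>\<Lambda> f\<bar> \<le> 0"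
    by (intro LIMSEQ_le_const) auto
  then show ?thesis by simp
qed

text \<open>
The density comes from the values at indicators; it is then cut off at \<open>\<plusminus>K\<close> on a null set, so that the
bound holds everywhere. The difference of the two sides vanishes at indicators and is continuous.
\<close>

lemma L1_continuous_functional_density:
  fixes \<Lambda> :: "('b \<Rightarrow> real) \<Rightarrow> real"
  assumes "finite_measure M" and K: "0 \<le> K"
    and int: "\<And>f. f \<in> S \<Longrightarrow> integrable M f"
    and simple: "\<And>f. simple_function M f \<Longrightarrow> f \<in> S"
    and S_add: "\<And>f g. f \<in> S \<Longrightarrow> g \<in> S \<Longrightarrow> (\<lambda>x. f x + g x) \<in> S"
    and S_scale: "\<And>c f. f \<in> S \<Longrightarrow> (\<lambda>x. c * f x) \<in> S"
    and add: "\<And>f g. f \<in> S \<Longrightarrow> g \<in> S \<Longrightarrow> \<Lambda> (\<lambda>x. f x + g x) = \<Lambda> f + \<Lambda> g"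
    and scale: "\<And>c f. f \<in> S \<Longrightarrow> \<Lambda> (\<lambda>x. c * f x) = c * \<Lambda> f"
    and le: "\<And>f. f \<in> S \<Longrightarrow> \<bar>\<Lambda> f\<bar> \<le> K * (\<integral>x. \<bar>f x\<bar> \<partial>M)"
  obtains y where "y \<in> borel_measurable M" "\<And>x. \<bar>y x\<bar> \<le> K"
    "\<And>f. f \<in> S \<Longrightarrow> \<Lambda> f = (\<integral>x. y x * f x \<partial>M)"
proof -
  interpret finite_measure M by fact
  have iS: "(indicator A :: 'b \<Rightarrow> real) \<in> S" if "A \<in> sets M" for A using that by (intro simple) simp
  have ind_add: "\<Lambda> (indicator (A \<union> B)) = \<Lambda> (indicator A) + \<Lambda> (indicator B)"
    if "A \<in> sets M" "B \<in> sets M" "A \<inter> B = {}" for A B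
  proof -
    have "(indicator (A \<union> B) :: 'b \<Rightarrow> real) = (\<lambda>x. indicator A x + indicator B x)"
      using that(3) by (auto simp: indicator_def fun_eq_iff)
    then show ?thesis using add[OF iS iS] that by simp
  qed
  have ind_le: "\<bar>\<Lambda> (indicator A)\<bar> \<le> K * measure M A" if "A \<in> sets M" for A
    using le[OF iS[OF that]] that by simp
  obtain y0 where [measurable]: "y0 \<in> borel_measurable M" and y0K: "AE x in M. \<bar>y0 x\<bar> \<le> K"
    and y0: "\<And>A. A \<in> sets M \<Longrightarrow> \<Lambda> (indicator A) = (\<integral>x. y0 x * indicator A x \<partial>M)"
    by (rule bounded_additive_set_function_density[where \<nu> = "\<lambda>A. \<Lambda> (indicator A)", OF assms(1) ind_add ind_le])
      (auto intro: that)
  define y where "y x = max (- K) (min K (y0 x))" for x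
  have [measurable]: "y \<in> borel_measurable M" unfolding y_def by measurable
  have yK: "\<bar>y x\<bar> \<le> K" for x using K by (auto simp: y_def)
  have yy0: "AE x in M. y x = y0 x" using y0K by eventually_elim (auto simp: y_def)
  have iy: "integrable M (\<lambda>x. y x * f x)" if "f \<in> S" for f
  proof (rule Bochner_Integration.integrable_bound[of M "\<lambda>x. K * f x"])
    show "AE x in M. norm (y x * f x) \<le> norm (K * f x)"
      using yK K by (auto simp: abs_mult intro!: mult_right_mono)
  qed (use int[OF that] in auto)
  have "\<Lambda> f - (\<integral>x. y x * f x \<partial>M) = 0" if "f \<in> S" for f
  proof (rule L1_continuous_functional_eq_0[where \<Lambda> = "\<lambda>f. \<Lambda> f - (\<integral>x. y x * f x \<partial>M)" and K = "2 * K" and S = S])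
    show "\<Lambda> (\<lambda>x. f x + g x) - (\<integral>x. y x * (f x + g x) \<partial>M)
        = \<Lambda> f - (\<integral>x. y x * f x \<partial>M) + (\<Lambda> g - (\<integral>x. y x * g x \<partial>M))" if "f \<in> S" "g \<in> S" for f g
      using add[OF that] iy that by (simp add: distrib_left)
    show "\<Lambda> (\<lambda>x. c * f x) - (\<integral>x. y x * (c * f x) \<partial>M) = c * (\<Lambda> f - (\<integral>x. y x * f x \<partial>M))"
      if "f \<in> S" for c f
      using scale[OF that] by (simp add: mult.left_commute right_diff_distrib)
    show "\<bar>\<Lambda> f - (\<integral>x. y x * f x \<partial>M)\<bar> \<le> 2 * K * (\<integral>x. \<bar>f x\<bar> \<partial>M)" if "f \<in> S" for f
    proof -
      have "\<bar>\<integral>x. y x * f x \<partial>M\<bar> \<le> (\<integral>x. \<bar>y x * f x\<bar> \<partial>M)" by (rule integral_abs_bound)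
      also have "\<dots> \<le> (\<integral>x. K * \<bar>f x\<bar> \<partial>M)"
        using integrable_abs[OF iy[OF that]] int[OF that] yK
        by (intro integral_mono) (auto simp: abs_mult intro!: mult_right_mono)
      finally show ?thesis using le[OF that] by simp
    qed
    show "\<Lambda> (indicator A) - (\<integral>x. y x * indicator A x \<partial>M) = 0" if [measurable]: "A \<in> sets M" for A
    proof -
      have "(\<integral>x. y x * indicator A x \<partial>M) = (\<integral>x. y0 x * indicator A x \<partial>M)"
        using yy0 by (intro integral_cong_AE) (auto elim!: eventually_mono)
      then show ?thesis using y0[OF that] by simp
    qed
  qed (use assms that in blast)+
  then show thesis using that[of y] yK by simp
qed

section \<open>The dual of the space of integrable functions\<close>

lemma L1_rep:
  assumes "F \<in> vcarrier (L1 M)"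
  shows "integrable M (l1_rep F)" "l1_class M (l1_rep F) = F"
proof -
  obtain f where f: "integrable M f" "F = l1_class M f"
    using assms by (auto simp: L1_def quotient_def l1_class_def)
  then show "integrable M (l1_rep F)" by (simp add: l1_rep_class)
  show "l1_class M (l1_rep F) = F"
    using f l1_rep_class[OF f(1)] by (simp add: l1_class_eq_iff)
qed

lemma L1_norm: "vnorm (L1 M) F = (\<integral>x. \<bar>l1_rep F x\<bar> \<partial>M)"
  by (simp add: L1_def)

lemma L1_cases:
  assumes "F \<in> vcarrier (L1 M)"
  obtains f where "integrable M f" "F = l1_class M f"
  using L1_rep[OF assms] by metis

lemma homogeneous_norm_L1: "homogeneous_norm (L1 M)"
proof
  have "l1_class M (\<lambda>_. 0) \<in> vcarrier (L1 M)" by (intro l1_class_in_L1) simp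
  then show "vcarrier (L1 M) \<noteq> {}" by auto
next
  fix F c assume "F \<in> vcarrier (L1 M)"
  then obtain f where f: "integrable M f" "F = l1_class M f" by (rule L1_cases)
  show "vscale (L1 M) c F \<in> vcarrier (L1 M)"
    using f by (simp add: L1_scale_class l1_class_in_L1)
  show "0 \<le> vnorm (L1 M) F" by (simp add: L1_norm)
  show "vnorm (L1 M) (vscale (L1 M) c F) = \<bar>c\<bar> * vnorm (L1 M) F"
    using f by (simp add: L1_scale_class L1_norm_class abs_mult)
qed

text \<open>
Vanishing off the carrier is what \<open>dual\<close> demands of its members.
\<close>

definition l1_pairing :: "'b measure \<Rightarrow> ('b \<Rightarrow> real) \<Rightarrow> ('b \<Rightarrow> real) set \<Rightarrow> real" where
  "l1_pairing M g F = (if F \<in> vcarrier (L1 M) then \<integral>x. g x * l1_rep F x \<partial>M else 0)"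

text \<open>
The bound is required only on \<open>space M\<close>: simple functions are unrestricted elsewhere and have to belong to
this set.
\<close>

definition bounded_measurable :: "'b measure \<Rightarrow> ('b \<Rightarrow> real) set" where
  "bounded_measurable M = {g \<in> borel_measurable M. \<exists>C. \<forall>x\<in>space M. \<bar>g x\<bar> \<le> C}"

lemma bounded_measurable_times_integrable:
  assumes "g \<in> bounded_measurable M" "integrable M f"
  shows "integrable M (\<lambda>x. g x * f x)"
proof -
  obtain C where C: "\<And>x. x \<in> space M \<Longrightarrow> \<bar>g x\<bar> \<le> C" and [measurable]: "g \<in> borel_measurable M"
    using assms by (auto simp: bounded_measurable_def)
  show ?thesis
  proof (rule Bochner_Integration.integrable_bound[of M "\<lambda>x. C * f x"])
    show "AE x in M. norm (g x * f x) \<le> norm (C * f x)"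
      using C by (intro AE_I2) (force simp: abs_mult intro!: mult_right_mono)
  qed (use assms in auto)
qed

lemma abs_integral_mult_le:
  fixes f g :: "'b \<Rightarrow> real"
  assumes "g \<in> borel_measurable M" "integrable M f" "\<And>x. x \<in> space M \<Longrightarrow> \<bar>g x\<bar> \<le> C"
  shows "\<bar>\<integral>x. g x * f x \<partial>M\<bar> \<le> C * (\<integral>x. \<bar>f x\<bar> \<partial>M)"
proof -
  have i: "integrable M (\<lambda>x. g x * f x)"
    by (rule bounded_measurable_times_integrable) (use assms in \<open>auto simp: bounded_measurable_def\<close>)
  have "\<bar>\<integral>x. g x * f x \<partial>M\<bar> \<le> (\<integral>x. \<bar>g x * f x\<bar> \<partial>M)" by (rule integral_abs_bound)
  also have "\<dots> \<le> (\<integral>x. C * \<bar>f x\<bar> \<partial>M)"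
    using integrable_abs[OF i] assms by (intro integral_mono) (auto simp: abs_mult intro!: mult_right_mono)
  finally show ?thesis by simp
qed

lemma l1_pairing_class:
  assumes "g \<in> borel_measurable M" "integrable M f"
  shows "l1_pairing M g (l1_class M f) = (\<integral>x. g x * f x \<partial>M)"
proof -
  have "AE x in M. g x * l1_rep (l1_class M f) x = g x * f x"
    using l1_rep_class(2)[OF assms(2)] by eventually_elim simp
  then show ?thesis
    using assms l1_rep_class(1)[OF assms(2)]
    by (auto simp: l1_pairing_def l1_class_in_L1 intro!: integral_cong_AE)
qed

lemma l1_pairing_in_dual:
  assumes "g \<in> bounded_measurable M"
  shows "l1_pairing M g \<in> vcarrier (dual (L1 M))"
proof -
  have g: "g \<in> borel_measurable M" using assms by (simp add: bounded_measurable_def)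
  obtain C where C: "\<And>x. x \<in> space M \<Longrightarrow> \<bar>g x\<bar> \<le> C"
    using assms by (auto simp: bounded_measurable_def)
  note int = bounded_measurable_times_integrable[OF assms]
  show ?thesis
  proof (rule functionalI[where C = C])
    fix F assume "F \<in> vcarrier (L1 M)"
    then obtain f where f: "integrable M f" "F = l1_class M f" by (rule L1_cases)
    show "l1_pairing M g (vscale (L1 M) c F) = c * l1_pairing M g F" for c
      using f g by (simp add: L1_scale_class l1_pairing_class mult.left_commute)
    show "\<bar>l1_pairing M g F\<bar> \<le> C * vnorm (L1 M) F"
      using f abs_integral_mult_le[OF g f(1) C] by (simp add: l1_pairing_class[OF g] L1_norm_class)
    fix H assume "H \<in> vcarrier (L1 M)"
    then obtain h where h: "integrable M h" "H = l1_class M h" by (rule L1_cases)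
    show "l1_pairing M g (vadd (L1 M) F H) = l1_pairing M g F + l1_pairing M g H"
      using f h g int by (simp add: L1_add_class l1_pairing_class distrib_left)
  qed (simp add: l1_pairing_def)
qed

lemma l1_pairing_add:
  assumes "f \<in> bounded_measurable M" "g \<in> bounded_measurable M"
  shows "l1_pairing M (\<lambda>x. f x + g x) = (\<lambda>F. l1_pairing M f F + l1_pairing M g F)"
  using bounded_measurable_times_integrable[OF assms(1) L1_rep(1)]
    bounded_measurable_times_integrable[OF assms(2) L1_rep(1)]
  by (auto simp: l1_pairing_def fun_eq_iff distrib_right)

lemma l1_pairing_scale: "l1_pairing M (\<lambda>x. c * g x) = (\<lambda>F. c * l1_pairing M g F)"
  by (auto simp: l1_pairing_def fun_eq_iff mult.assoc)

lemma bounded_measurable_add: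
  assumes "f \<in> bounded_measurable M" "g \<in> bounded_measurable M"
  shows "(\<lambda>x. f x + g x) \<in> bounded_measurable M"
proof -
  obtain C D where "\<And>x. x \<in> space M \<Longrightarrow> \<bar>f x\<bar> \<le> C" "\<And>x. x \<in> space M \<Longrightarrow> \<bar>g x\<bar> \<le> D"
    using assms by (auto simp: bounded_measurable_def)
  then have "\<bar>f x + g x\<bar> \<le> C + D" if "x \<in> space M" for x
    using that by (smt (verit))
  then show ?thesis using assms by (auto simp: bounded_measurable_def)
qed

lemma bounded_measurable_scale:
  assumes "f \<in> bounded_measurable M"
  shows "(\<lambda>x. c * f x) \<in> bounded_measurable M"
proof -
  obtain C where "\<And>x. x \<in> space M \<Longrightarrow> \<bar>f x\<bar> \<le> C"
    using assms by (auto simp: bounded_measurable_def)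
  then have "\<bar>c * f x\<bar> \<le> \<bar>c\<bar> * C" if "x \<in> space M" for x
    using that by (simp add: abs_mult mult_left_mono)
  then show ?thesis using assms by (auto simp: bounded_measurable_def)
qed

lemma simple_function_bounded_measurable:
  fixes f :: "'b \<Rightarrow> real"
  assumes "simple_function M f"
  shows "f \<in> bounded_measurable M"
proof -
  have fin: "finite (f ` space M)" using assms by (simp add: simple_function_def)
  have "\<bar>f x\<bar> \<le> (\<Sum>v\<in>f ` space M. \<bar>v\<bar>)" if "x \<in> space M" for x
    using that fin by (intro member_le_sum) auto
  then show ?thesis
    using borel_measurable_simple_function[OF assms] by (auto simp: bounded_measurable_def)
qed

lemma (in finite_measure) bounded_measurable_integrable:
  "g \<in> bounded_measurable M \<Longrightarrow> integrable M g"
  using bounded_measurable_times_integrable[of g M "\<lambda>_. 1"] by simp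

text \<open>
The norm of \<open>\<phi>\<close> bounds it on all integrable functions, so that they may all be taken as the domain \<open>S\<close> of
the density lemma; the pointwise bound of the density then makes it a bounded function.
\<close>

lemma dual_L1_representation:
  fixes M :: "'b measure"
  assumes "finite_measure M" and \<phi>: "\<phi> \<in> vcarrier (dual (L1 M))"
  obtains g where "g \<in> bounded_measurable M" "\<phi> = l1_pairing M g"
proof -
  interpret finite_measure M by fact
  interpret L: homogeneous_norm "L1 M" by (rule homogeneous_norm_L1)
  interpret D: homogeneous_norm "dual (L1 M)" by (rule L.homogeneous_norm_dual)
  obtain g where g: "g \<in> borel_measurable M" "\<And>x. \<bar>g x\<bar> \<le> vnorm (dual (L1 M)) \<phi>"
    and eq: "\<And>f. f \<in> {f. integrable M f} \<Longrightarrow> \<phi> (l1_class M f) = (\<integral>x. g x * f x \<partial>M)"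
  proof (rule L1_continuous_functional_density[where \<Lambda> = "\<lambda>f. \<phi> (l1_class M f)" and M = M
        and S = "{f. integrable M f}" and K = "vnorm (dual (L1 M)) \<phi>"])
    show "0 \<le> vnorm (dual (L1 M)) \<phi>" by (rule D.norm_nonneg[OF \<phi>])
    show "f \<in> {f. integrable M f}" if "simple_function M f" for f :: "'b \<Rightarrow> real"
      using bounded_measurable_integrable[OF simple_function_bounded_measurable[OF that]] by simp
    show "\<phi> (l1_class M (\<lambda>x. f x + h x)) = \<phi> (l1_class M f) + \<phi> (l1_class M h)"
      if "f \<in> {f. integrable M f}" "h \<in> {f. integrable M f}" for f h
      using functional_add[OF \<phi>, of "l1_class M f" "l1_class M h"] that
      by (simp add: L1_add_class l1_class_in_L1)
    show "\<phi> (l1_class M (\<lambda>x. c * f x)) = c * \<phi> (l1_class M f)"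
      if "f \<in> {f. integrable M f}" for c f
      using functional_scale[OF \<phi>, of "l1_class M f" c] that
      by (simp add: L1_scale_class l1_class_in_L1)
    show "\<bar>\<phi> (l1_class M f)\<bar> \<le> vnorm (dual (L1 M)) \<phi> * (\<integral>x. \<bar>f x\<bar> \<partial>M)"
      if "f \<in> {f. integrable M f}" for f
      using L.functional_le[OF \<phi> l1_class_in_L1[of M f]] that by (simp add: L1_norm_class)
  qed (use assms in auto)
  have "\<phi> F = l1_pairing M g F" for F
  proof (cases "F \<in> vcarrier (L1 M)")
    case True
    then obtain f where "integrable M f" "F = l1_class M f" by (rule L1_cases)
    then show ?thesis using eq l1_pairing_class[OF g(1)] by simp
  qed (simp add: l1_pairing_def functional_off_carrier[OF \<phi>])
  moreover have "g \<in> bounded_measurable M"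
    using g by (auto simp: bounded_measurable_def)
  ultimately show thesis by (intro that[of g]) auto
qed

section \<open>Uniformly small tails bound the distance to the space\<close>

text \<open>
Given \<open>\<Phi>\<close> in the weak* closure of \<open>A\<close>, let \<open>\<Psi>\<close> be a weak* limit of the truncations \<open>\<tau> F\<close> along a filter on
\<open>A\<close> that converges to \<open>\<Phi>\<close>. It satisfies \<open>\<bar>\<Psi> (l1_pairing M g)\<bar> \<le> K * (\<integral>x. \<bar>g x\<bar> \<partial>M)\<close> for
bounded \<open>g\<close>, because every truncation does, so it is represented by a function \<open>y\<close>. The distance from
\<open>F\<close> to \<open>\<tau> F\<close> is at most \<open>c\<close>, and this passes to the limits.
\<close>

lemma wk_L1_le_if_tails_le:
  fixes M :: "'b measure"
  assumes "finite_measure M" and A: "A \<subseteq> vcarrier (L1 M)" and K: "0 \<le> K"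
    and tail: "\<And>F. F \<in> A \<Longrightarrow> (\<integral>x. \<bar>l1_rep F x\<bar> * indicator {x \<in> space M. K < \<bar>l1_rep F x\<bar>} x \<partial>M) \<le> c"
  shows "wk (L1 M) A \<le> ennreal c"
  unfolding wk_def
proof (rule SUP_least)
  interpret finite_measure M by fact
  interpret L: homogeneous_norm "L1 M" by (rule homogeneous_norm_L1)
  interpret D: homogeneous_norm "dual (L1 M)" by (rule L.homogeneous_norm_dual)
  fix \<Phi> assume "\<Phi> \<in> weak_star_topology (dual (L1 M)) closure_of (canonical_embedding (L1 M) ` A)"
  then obtain \<F> where \<F>: "\<F> \<noteq> bot" "\<F> \<le> principal A"
    and lim\<Phi>: "\<And>\<phi>. \<phi> \<in> vcarrier (dual (L1 M)) \<Longrightarrow> ((\<lambda>F. \<phi> F) \<longlongrightarrow> \<Phi> \<phi>) \<F>"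
    by (rule L.weak_star_closure_imp_filter) (rule that)
  define t :: "('b \<Rightarrow> real) set \<Rightarrow> 'b \<Rightarrow> real" where "t F x = max (- K) (min K (l1_rep F x))" for F x
  define \<tau> where "\<tau> F = l1_class M (t F)" for F
  have tK: "\<bar>t F x\<bar> \<le> K" for F x using K by (auto simp: t_def)
  have meas: "t F \<in> borel_measurable M" if "F \<in> A" for F
  proof -
    have [measurable]: "l1_rep F \<in> borel_measurable M" using L1_rep(1) A that by blast
    show ?thesis unfolding t_def by measurable
  qed
  have t_int: "integrable M (t F)" if "F \<in> A" for F
    using meas[OF that] tK by (intro bounded_measurable_integrable) (auto simp: bounded_measurable_def)
  have \<tau>_bdd: "\<tau> F \<in> vcarrier (L1 M) \<and> vnorm (L1 M) (\<tau> F) \<le> K * measure M (space M)" if "F \<in> A" for F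
  proof -
    have "(\<integral>x. \<bar>t F x\<bar> \<partial>M) \<le> (\<integral>x. K \<partial>M)"
      using t_int[OF that] tK by (intro integral_mono) auto
    then show ?thesis
      using t_int[OF that] by (simp add: \<tau>_def l1_class_in_L1 L1_norm_class mult.commute)
  qed
  have inA: "eventually (\<lambda>F. F \<in> A) \<F>" using \<F>(2) by (simp add: le_principal)
  then have "eventually (\<lambda>F. \<tau> F \<in> vcarrier (L1 M) \<and> vnorm (L1 M) (\<tau> F) \<le> K * measure M (space M)) \<F>"
    using \<tau>_bdd by (auto elim: eventually_mono)
  then obtain \<G> \<Psi> where \<G>: "\<G> \<le> \<F>" "\<G> \<noteq> bot" and \<Psi>: "\<Psi> \<in> vcarrier (bidual (L1 M))"
    and lim\<Psi>: "\<And>\<phi>. \<phi> \<in> vcarrier (dual (L1 M)) \<Longrightarrow> ((\<lambda>F. \<phi> (\<tau> F)) \<longlongrightarrow> \<Psi> \<phi>) \<G>"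
    by (rule L.bounded_filter_has_cluster_point[OF \<F>(1)]) (rule that)
  have inA': "eventually (\<lambda>F. F \<in> A) \<G>" using filter_leD[OF \<G>(1) inA] .
  let ?B = "bounded_measurable M"
  have \<Psi>_add: "\<Psi> (l1_pairing M (\<lambda>x. f x + g x)) = \<Psi> (l1_pairing M f) + \<Psi> (l1_pairing M g)"
    if "f \<in> ?B" "g \<in> ?B" for f g
    using functional_add[OF \<Psi> l1_pairing_in_dual[OF that(1)] l1_pairing_in_dual[OF that(2)]]
    by (simp add: l1_pairing_add that)
  have \<Psi>_scale: "\<Psi> (l1_pairing M (\<lambda>x. c * f x)) = c * \<Psi> (l1_pairing M f)" if "f \<in> ?B" for c f
    using functional_scale[OF \<Psi> l1_pairing_in_dual[OF that]] by (simp add: l1_pairing_scale)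
  have \<Psi>_le: "\<bar>\<Psi> (l1_pairing M g)\<bar> \<le> K * (\<integral>x. \<bar>g x\<bar> \<partial>M)" if g: "g \<in> ?B" for g
  proof (rule tendsto_upperbound[OF tendsto_rabs[OF lim\<Psi>[OF l1_pairing_in_dual[OF g]]] _ \<G>(2)])
    have gm: "g \<in> borel_measurable M" using g by (simp add: bounded_measurable_def)
    show "eventually (\<lambda>F. \<bar>l1_pairing M g (\<tau> F)\<bar> \<le> K * (\<integral>x. \<bar>g x\<bar> \<partial>M)) \<G>"
      using inA'
    proof eventually_elim
      case (elim F)
      have "l1_pairing M g (\<tau> F) = (\<integral>x. t F x * g x \<partial>M)"
        unfolding \<tau>_def using l1_pairing_class[OF gm t_int[OF elim]] by (simp add: mult.commute)
      then show ?case
        using abs_integral_mult_le[OF meas[OF elim] bounded_measurable_integrable[OF g] tK] by simp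
    qed
  qed
  obtain y where y: "y \<in> borel_measurable M" "\<And>x. \<bar>y x\<bar> \<le> K"
    and yeq: "\<And>g. g \<in> ?B \<Longrightarrow> \<Psi> (l1_pairing M g) = (\<integral>x. y x * g x \<partial>M)"
    by (rule L1_continuous_functional_density[where \<Lambda> = "\<lambda>g. \<Psi> (l1_pairing M g)", OF assms(1) K
          bounded_measurable_integrable simple_function_bounded_measurable bounded_measurable_add
          bounded_measurable_scale \<Psi>_add \<Psi>_scale \<Psi>_le])
      (auto intro: that)
  have y_int: "integrable M y"
    using y by (intro bounded_measurable_integrable) (auto simp: bounded_measurable_def)
  define Y where "Y = l1_class M y"
  have YX: "Y \<in> vcarrier (L1 M)" unfolding Y_def by (rule l1_class_in_L1[OF y_int])
  \<comment> \<open>All functionals are pairings with bounded functions, so \<open>\<Psi>\<close> is evaluation at \<open>Y\<close>.\<close>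
  have \<Psi>Y: "\<Psi> \<phi> = \<phi> Y" if \<phi>: "\<phi> \<in> vcarrier (dual (L1 M))" for \<phi>
  proof -
    obtain g where g: "g \<in> ?B" "\<phi> = l1_pairing M g"
      by (rule dual_L1_representation[OF assms(1) \<phi>])
    then have "g \<in> borel_measurable M" by (simp add: bounded_measurable_def)
    then show ?thesis using yeq[OF g(1)] l1_pairing_class[OF _ y_int] g(2) by (simp add: Y_def mult.commute)
  qed
  have close: "\<bar>\<phi> F - \<phi> (\<tau> F)\<bar> \<le> c" if F: "F \<in> A" and \<phi>: "\<phi> \<in> unit_ball (dual (L1 M))" for F \<phi>
  proof -
    let ?f = "l1_rep F"
    have \<phi>d: "\<phi> \<in> vcarrier (dual (L1 M))" "vnorm (dual (L1 M)) \<phi> \<le> 1"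
      using \<phi> by (auto simp: unit_ball_def)
    have f: "integrable M ?f" "F = l1_class M ?f" using L1_rep[of F M] A F by auto
    have int: "integrable M (\<lambda>x. ?f x + (-1) * t F x)"
      using f(1) t_int[OF F] by simp
    let ?R = "l1_class M (\<lambda>x. ?f x + (-1) * t F x)"
    have "vadd (L1 M) F (vscale (L1 M) (-1) (\<tau> F)) = ?R"
      using f t_int[OF F] L1_add_class[of M ?f "\<lambda>x. (-1) * t F x"] by (simp add: \<tau>_def L1_scale_class)
    then have "\<phi> F - \<phi> (\<tau> F) = \<phi> ?R"
      using functional_add[OF \<phi>d(1), of F "vscale (L1 M) (-1) (\<tau> F)"] functional_scale[OF \<phi>d(1), of "\<tau> F" "-1"]
        A F \<tau>_bdd[OF F] L.scale_closed by auto
    also have "\<bar>\<phi> ?R\<bar> \<le> vnorm (dual (L1 M)) \<phi> * vnorm (L1 M) ?R"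
      by (rule L.functional_le[OF \<phi>d(1) l1_class_in_L1[OF int]])
    also have "\<dots> \<le> 1 * vnorm (L1 M) ?R"
      using \<phi>d(2) L.norm_nonneg[OF l1_class_in_L1[OF int]] by (intro mult_right_mono)
    also have "\<dots> = (\<integral>x. \<bar>?f x - t F x\<bar> \<partial>M)"
      using L1_norm_class[OF int] by simp
    also have "\<dots> \<le> (\<integral>x. \<bar>?f x\<bar> * indicator {x \<in> space M. K < \<bar>?f x\<bar>} x \<partial>M)"
    proof (rule integral_mono)
      have [measurable]: "?f \<in> borel_measurable M" using f(1) by auto
      show "integrable M (\<lambda>x. \<bar>?f x\<bar> * indicator {x \<in> space M. K < \<bar>?f x\<bar>} x)"
        using f(1) by (intro integrable_real_mult_indicator) auto
    qed (use int K in \<open>auto simp: t_def indicator_def\<close>)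
    also have "\<dots> \<le> c" by (rule tail[OF F])
    finally show ?thesis .
  qed
  have "vnorm (bidual (L1 M)) (vdiff (bidual (L1 M)) \<Phi> (canonical_embedding (L1 M) Y)) \<le> c"
  proof (rule D.dual_norm_le)
    fix \<phi> assume \<phi>: "\<phi> \<in> unit_ball (dual (L1 M))"
    then have \<phi>d: "\<phi> \<in> vcarrier (dual (L1 M))" by (auto simp: unit_ball_def)
    have "((\<lambda>F. \<bar>\<phi> F - \<phi> (\<tau> F)\<bar>) \<longlongrightarrow> \<bar>\<Phi> \<phi> - \<Psi> \<phi>\<bar>) \<G>"
      by (intro tendsto_rabs tendsto_diff lim\<Psi> \<phi>d tendsto_mono[OF \<G>(1) lim\<Phi>[OF \<phi>d]])
    moreover have "eventually (\<lambda>F. \<bar>\<phi> F - \<phi> (\<tau> F)\<bar> \<le> c) \<G>"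
      using inA' by eventually_elim (rule close[OF _ \<phi>])
    ultimately have "\<bar>\<Phi> \<phi> - \<Psi> \<phi>\<bar> \<le> c"
      using tendsto_upperbound \<G>(2) by blast
    then show "\<bar>vdiff (bidual (L1 M)) \<Phi> (canonical_embedding (L1 M) Y) \<phi>\<bar> \<le> c"
      using \<Psi>Y[OF \<phi>d] \<phi>d by (simp add: vdiff_def canonical_embedding_def)
  qed
  then have "ennreal (vnorm (bidual (L1 M)) (vdiff (bidual (L1 M)) \<Phi> (canonical_embedding (L1 M) Y))) \<le> ennreal c"
    by (rule ennreal_leI)
  then show "dist_to_space (L1 M) \<Phi> \<le> ennreal c"
    unfolding dist_to_space_def by (rule INF_lower2[OF YX])
qed

section \<open>Large tails produce disjointly supported functionals\<close>

text \<open>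
By the Borel-Cantelli lemma almost every point lies in only finitely many \<open>E n\<close>.
\<close>

lemma (in finite_measure) integral_over_tail_union_tendsto_0:
  fixes f :: "'a \<Rightarrow> real"
  assumes E: "\<And>n. E n \<in> sets M" and sum: "summable (\<lambda>n. measure M (E n))" and f: "integrable M f"
  shows "(\<lambda>m. \<integral>x. \<bar>f x\<bar> * indicator (\<Union>j\<in>{m..}. E j) x \<partial>M) \<longlonglongrightarrow> 0"
proof -
  have [measurable]: "E n \<in> sets M" "f \<in> borel_measurable M" for n using E f by auto
  have "(\<lambda>m. \<integral>x. \<bar>f x\<bar> * indicator (\<Union>j\<in>{m..}. E j) x \<partial>M) \<longlonglongrightarrow> (\<integral>x. 0 \<partial>M)"
  proof (rule integral_dominated_convergence[where w = "\<lambda>x. \<bar>f x\<bar>"])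
    have "AE x in M. eventually (\<lambda>n. x \<in> space M - E n) sequentially"
      using E sum by (intro borel_cantelli_AE1) (auto simp: less_top[symmetric])
    then show "AE x in M. (\<lambda>m. \<bar>f x\<bar> * indicator (\<Union>j\<in>{m..}. E j) x) \<longlonglongrightarrow> 0"
    proof eventually_elim
      case (elim x)
      then obtain N where "\<And>n. n \<ge> N \<Longrightarrow> x \<notin> E n" by (auto simp: eventually_sequentially)
      then have "\<bar>f x\<bar> * indicator (\<Union>j\<in>{m..}. E j) x = 0" if "m \<ge> N" for m
        using that by (auto simp: indicator_def)
      then show ?case
        by (intro tendsto_eventually) (auto simp: eventually_sequentially)
    qed
    show "AE x in M. norm (\<bar>f x\<bar> * indicator (\<Union>j\<in>{m..}. E j) x) \<le> \<bar>f x\<bar>" for m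
      by (auto simp: indicator_def)
  qed (use f in auto)
  then show ?thesis by simp
qed

text \<open>
Let \<open>h n\<close> represent a point of \<open>A\<close> whose tail at the level \<open>2 ^ n * (C + 1)\<close> exceeds \<open>c\<close>, where \<open>C\<close>
bounds the norms in \<open>A\<close>. Markov's inequality makes the measures of the sets \<open>S n = {\<bar>h n\<bar> > level}\<close>
summable. Then \<open>h n\<close> has mass less than \<open>c - d\<close> on the union of all sufficiently late \<open>S j\<close>; along a
sparse subsequence \<open>r\<close> all later sets are late enough. Removing them from \<open>S (r k)\<close> leaves disjoint sets
\<open>D k\<close> on which \<open>h (r k)\<close> still has mass at least \<open>d\<close>.
\<close>

lemma iota1_L1_ge_if_tails_large:
  fixes M :: "'b measure"
  assumes "finite_measure M" and A: "bounded_subset (L1 M) A" and cd: "d < c"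
    and tail: "\<And>K. 0 \<le> K \<Longrightarrow> \<exists>F\<in>A. c < (\<integral>x. \<bar>l1_rep F x\<bar> * indicator {x \<in> space M. K < \<bar>l1_rep F x\<bar>} x \<partial>M)"
  shows "ennreal d \<le> iota1 (L1 M) A"
proof -
  interpret finite_measure M by fact
  interpret L: homogeneous_norm "L1 M" by (rule homogeneous_norm_L1)
  obtain C where AX: "A \<subseteq> vcarrier (L1 M)" and C: "\<And>F. F \<in> A \<Longrightarrow> vnorm (L1 M) F \<le> C"
    using A by (auto simp: bounded_subset_def)
  have C0: "0 \<le> C"
  proof -
    obtain F where "F \<in> A" using tail[of 0] by auto
    then show ?thesis using C[of F] L.norm_nonneg[of F] AX by force
  qed
  \<comment> \<open>The summand 1 keeps the levels positive when \<open>C = 0\<close>.\<close>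
  define E where "E F n = {x \<in> space M. 2 ^ n * (C + 1) < \<bar>l1_rep F x\<bar>}" for F :: "('b \<Rightarrow> real) set" and n :: nat
  have "\<exists>F\<in>A. c < (\<integral>x. \<bar>l1_rep F x\<bar> * indicator (E F n) x \<partial>M)" for n
    using tail[of "2 ^ n * (C + 1)"] C0 unfolding E_def by simp
  then obtain u where uA: "\<And>n. u n \<in> A" and ularge: "\<And>n. c < (\<integral>x. \<bar>l1_rep (u n) x\<bar> * indicator (E (u n) n) x \<partial>M)"
    by metis
  define h where "h n = l1_rep (u n)" for n
  define S where "S n = E (u n) n" for n
  have h: "integrable M (h n)" and hu: "u n = l1_class M (h n)" for n
    using L1_rep[of "u n" M] uA AX by (auto simp: h_def)
  have [measurable]: "h n \<in> borel_measurable M" for n using h by auto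
  have [measurable]: "S n \<in> sets M" for n
  proof -
    have "S n = {x \<in> space M. 2 ^ n * (C + 1) < \<bar>h n x\<bar>}" by (simp add: S_def E_def h_def)
    then show ?thesis by simp
  qed
  have hS: "c < (\<integral>x. \<bar>h n x\<bar> * indicator (S n) x \<partial>M)" for n
    using ularge by (simp add: h_def S_def)
  have mS: "measure M (S n) \<le> (1 / 2) ^ n" for n
  proof -
    have "2 ^ n * (C + 1) * measure M (S n) = (\<integral>x. 2 ^ n * (C + 1) * indicator (S n) x \<partial>M)"
      by simp
    also have "\<dots> \<le> (\<integral>x. \<bar>h n x\<bar> \<partial>M)"
    proof (rule integral_mono)
      show "integrable M (\<lambda>x. 2 ^ n * (C + 1) * indicator (S n) x)"
        by (simp add: less_top[symmetric])
    qed (use h C0 in \<open>auto simp: indicator_def S_def E_def h_def\<close>)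
    also have "\<dots> \<le> C" using C[OF uA[of n]] hu[of n] L1_norm_class[OF h] by simp
    also have "\<dots> \<le> C + 1" by simp
    finally have "(C + 1) * (2 ^ n * measure M (S n)) \<le> (C + 1) * 1" by (simp add: ac_simps)
    then have "2 ^ n * measure M (S n) \<le> 1" using C0 by (subst (asm) mult_le_cancel_left_pos) auto
    then show ?thesis by (simp add: field_simps)
  qed
  have "summable (\<lambda>n. measure M (S n))"
    using mS by (intro summable_comparison_test'[OF summable_geometric[of "1/2::real"]]) auto
  note tail0 = integral_over_tail_union_tendsto_0[OF _ this h]
  have "\<exists>m>n. (\<integral>x. \<bar>h n x\<bar> * indicator (\<Union>j\<in>{m..}. S j) x \<partial>M) < c - d" for n
  proof -
    have "eventually (\<lambda>m. (\<integral>x. \<bar>h n x\<bar> * indicator (\<Union>j\<in>{m..}. S j) x \<partial>M) < c - d) sequentially"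
      using order_tendstoD(2)[OF tail0[of n], of "c - d"] cd by simp
    from eventually_conj[OF this eventually_gt_at_top[of n]] show ?thesis
      by (auto dest!: eventually_happens)
  qed
  then obtain nxt where nx: "\<And>n. n < nxt n"
    "\<And>n. (\<integral>x. \<bar>h n x\<bar> * indicator (\<Union>j\<in>{nxt n..}. S j) x \<partial>M) < c - d"
    by metis
  define r where "r k = (nxt ^^ k) 0" for k
  have r_Suc: "r (Suc k) = nxt (r k)" for k by (simp add: r_def)
  have r_mono: "strict_mono r" using nx(1) by (simp add: strict_mono_Suc_iff r_Suc)
  define D where "D k = S (r k) - (\<Union>j\<in>{Suc k..}. S (r j))" for k
  have [measurable]: "D k \<in> sets M" for k unfolding D_def by measurable
  have D_disj: "i = j" if "x \<in> D i" "x \<in> D j" for i j x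
    using that by (cases i j rule: linorder_cases) (auto simp: D_def)
  define g where "g k x = sgn (h (r k) x) * indicator (D k) x" for k x
  have g_le: "\<bar>g k x\<bar> \<le> indicator (D k) x" for k x
    by (auto simp: g_def indicator_def sgn_if)
  have gB: "g k \<in> bounded_measurable M" for k
  proof -
    have "g k \<in> borel_measurable M" unfolding g_def by measurable
    moreover have "\<bar>g k x\<bar> \<le> 1" for x by (auto simp: g_def indicator_def sgn_if)
    ultimately show ?thesis by (auto simp: bounded_measurable_def)
  qed
  then have gm: "g k \<in> borel_measurable M" for k by (simp add: bounded_measurable_def)
  define f where "f k = l1_pairing M (g k)" for k
  have fd: "f k \<in> vcarrier (dual (L1 M))" for k
    unfolding f_def by (rule l1_pairing_in_dual[OF gB])
  have sum_le: "(\<Sum>k<n. \<bar>f k F\<bar>) \<le> vnorm (L1 M) F" if "F \<in> vcarrier (L1 M)" for n F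
  proof -
    obtain v where v: "integrable M v" "F = l1_class M v" using \<open>F \<in> vcarrier (L1 M)\<close> by (rule L1_cases)
    have int: "integrable M (\<lambda>x. \<bar>v x\<bar> * indicator (D k) x)" for k
      using v(1) by (intro integrable_real_mult_indicator) auto
    have "(\<Sum>k<n. \<bar>f k F\<bar>) \<le> (\<Sum>k<n. \<integral>x. \<bar>v x\<bar> * indicator (D k) x \<partial>M)"
    proof (rule sum_mono)
      fix k
      have "\<bar>f k F\<bar> = \<bar>\<integral>x. g k x * v x \<partial>M\<bar>"
        using l1_pairing_class[OF gm v(1)] by (simp add: f_def v(2))
      also have "\<dots> \<le> (\<integral>x. \<bar>g k x * v x\<bar> \<partial>M)" by (rule integral_abs_bound)
      also have "\<dots> \<le> (\<integral>x. \<bar>v x\<bar> * indicator (D k) x \<partial>M)"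
      proof (rule integral_mono[OF integrable_abs[OF bounded_measurable_times_integrable[OF gB v(1)]] int])
        show "\<bar>g k x * v x\<bar> \<le> \<bar>v x\<bar> * indicator (D k) x" for x
          using mult_right_mono[OF g_le[of k x], of "\<bar>v x\<bar>"] by (simp add: abs_mult mult.commute)
      qed
      finally show "\<bar>f k F\<bar> \<le> (\<integral>x. \<bar>v x\<bar> * indicator (D k) x \<partial>M)" .
    qed
    also have "\<dots> = (\<integral>x. (\<Sum>k<n. \<bar>v x\<bar> * indicator (D k) x) \<partial>M)"
      by (intro Bochner_Integration.integral_sum[symmetric] int)
    also have "\<dots> \<le> (\<integral>x. \<bar>v x\<bar> \<partial>M)"
    proof (rule integral_mono)
      show "(\<Sum>k<n. \<bar>v x\<bar> * indicator (D k) x) \<le> \<bar>v x\<bar>" for x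
      proof -
        have "(\<Sum>k<n. indicator (D k) x :: real) = indicator (\<Union>k<n. D k) x"
          using D_disj by (intro indicator_UN_disjoint[symmetric]) (auto simp: disjoint_family_on_def)
        then have "(\<Sum>k<n. \<bar>v x\<bar> * indicator (D k) x) = \<bar>v x\<bar> * indicator (\<Union>k<n. D k) x"
          by (simp only: sum_distrib_left[symmetric])
        also have "\<dots> \<le> \<bar>v x\<bar>" by (simp add: indicator_def)
        finally show ?thesis .
      qed
      show "integrable M (\<lambda>x. \<Sum>k<n. \<bar>v x\<bar> * indicator (D k) x)"
        by (intro Bochner_Integration.integrable_sum int)
    qed (use v(1) in auto)
    finally show ?thesis using v by (simp add: L1_norm_class)
  qed
  note weak = L.weak_1_norm_le_1I[OF fd sum_le]
  have f_large: "d \<le> f k (u (r k))" for k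
  proof -
    let ?h = "h (r k)" and ?U = "\<Union>j\<in>{nxt (r k)..}. S j"
    have iS: "integrable M (\<lambda>x. \<bar>?h x\<bar> * indicator (S (r k)) x)"
      and iU: "integrable M (\<lambda>x. \<bar>?h x\<bar> * indicator ?U x)"
      and iD: "integrable M (\<lambda>x. \<bar>?h x\<bar> * indicator (D k) x)"
      using h by (auto intro!: integrable_real_mult_indicator)
    have "S (r j) \<subseteq> ?U" if "j \<ge> Suc k" for j
      using strict_mono_less_eq[OF r_mono, of "Suc k" j] that by (auto simp: r_Suc)
    then have sub: "S (r k) \<subseteq> D k \<union> ?U" by (auto simp: D_def)
    have "c - (c - d) \<le> (\<integral>x. \<bar>?h x\<bar> * indicator (S (r k)) x \<partial>M) - (\<integral>x. \<bar>?h x\<bar> * indicator ?U x \<partial>M)"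
      using hS[of "r k"] nx(2)[of "r k"] by linarith
    also have "\<dots> = (\<integral>x. \<bar>?h x\<bar> * indicator (S (r k)) x - \<bar>?h x\<bar> * indicator ?U x \<partial>M)"
      using iS iU by simp
    also have "\<dots> \<le> (\<integral>x. \<bar>?h x\<bar> * indicator (D k) x \<partial>M)"
      using sub iS iU iD by (intro integral_mono) (auto simp: indicator_def)
    also have "\<dots> = (\<integral>x. g k x * ?h x \<partial>M)"
      by (intro Bochner_Integration.integral_cong) (auto simp: g_def abs_sgn)
    also have "\<dots> = f k (u (r k))"
      unfolding f_def hu by (rule l1_pairing_class[OF gm h, symmetric])
    finally show ?thesis by simp
  qed
  have "ennreal d \<le> limsup (\<lambda>n. SUP F\<in>A. ennreal \<bar>f n F\<bar>)"
  proof (rule le_Limsup)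
    show "eventually (\<lambda>n. ennreal d \<le> (SUP F\<in>A. ennreal \<bar>f n F\<bar>)) sequentially"
      using f_large by (intro always_eventually allI SUP_upper2[OF uA] ennreal_leI) (rule order_trans[OF _ abs_ge_self])
  qed simp
  also have "\<dots> \<le> iota1 (L1 M) A"
    unfolding iota1_def using weak by (intro SUP_upper) simp
  finally show ?thesis .
qed

section \<open>The equality\<close>

theorem theorem4p5:
  fixes M :: "'b measure" and A :: "('b \<Rightarrow> real) set set"
  assumes "finite_measure M"
    and "bounded_subset (L1 M) A"
  shows "wk (L1 M) A = iota1 (L1 M) A"
proof (rule antisym)
  show "iota1 (L1 M) A \<le> wk (L1 M) A"
    by (rule homogeneous_norm.iota1_le_wk[OF homogeneous_norm_L1 assms(2)])
  show "wk (L1 M) A \<le> iota1 (L1 M) A"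
  proof (rule ccontr)
    assume "\<not> wk (L1 M) A \<le> iota1 (L1 M) A"
    then have "iota1 (L1 M) A < wk (L1 M) A" by simp
    \<comment> \<open>Two intermediate values, because the tails lose an arbitrarily small amount.\<close>
    then obtain d' where d': "iota1 (L1 M) A < d'" "d' < wk (L1 M) A"
      using dense by blast
    then obtain c' where c': "d' < c'" "c' < wk (L1 M) A"
      using dense by blast
    obtain c where c: "c' = ennreal c" "0 \<le> c" using c' by (cases c') auto
    obtain d where d: "d' = ennreal d" "0 \<le> d" using c' by (cases d') auto
    have "d < c" using c' c d by (simp add: ennreal_less_iff)
    with d d' iota1_L1_ge_if_tails_large[OF assms, of d c]
    obtain K where "0 \<le> K"
      "\<And>F. F \<in> A \<Longrightarrow> (\<integral>x. \<bar>l1_rep F x\<bar> * indicator {x \<in> space M. K < \<bar>l1_rep F x\<bar>} x \<partial>M) \<le> c"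
      by (meson not_le)
    then have "wk (L1 M) A \<le> ennreal c"
      using assms c by (intro wk_L1_le_if_tails_le) (auto simp: bounded_subset_def)
    then show False using c' c by simp
  qed
qed

end
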